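(* Let $(\mathfrak{g},[~,~],\alpha)$ be a (multiplicative) Hom-Lie algebra. (i) The Frölicher-Nijenhuis bracket $[~,~]_{\mathsf{FN}}$ makes $(C^\bullet_{\mathrm{Hom}}(\mathfrak{g},\mathfrak{g}),[~,~]_{\mathsf{FN}})$ into a graded Lie algebra (called the Frölicher-Nijenhuis algebra). (ii) Moreover, the Hom-Lie algebra differential $\delta_{\mathrm{Hom}}:C^\bullet_{\mathrm{Hom}}(\mathfrak{g},\mathfrak{g})\to C^{\bullet+1}_{\mathrm{Hom}}(\mathfrak{g},\mathfrak{g})$ is a graded Lie algebra morphism from $(C^\bullet_{\mathrm{Hom}}(\mathfrak{g},\mathfrak{g}),[~,~]_{\mathsf{FN}})$ to the Nijenhuis-Richardson algebra $(C^{\bullet+1}_{\mathrm{Hom}}(\mathfrak{g},\mathfrak{g}),[~,~]_{\mathsf{NR}})$.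
   Context: All vector spaces and (multi)linear maps are over a field $\mathbf{k}$ of characteristic $0$. A (multiplicative) Hom-Lie algebra $(\mathfrak{g},[~,~],\alpha)$ is a vector space $\mathfrak{g}$ with a skew-symmetric bilinear map $[~,~]$ and a linear map $\alpha:\mathfrak{g}\to\mathfrak{g}$ such that $[\alpha(x),[y,z]]+[\alpha(y),[z,x]]+[\alpha(z),[x,y]]=0$ and $\alpha([x,y])=[\alpha(x),\alpha(y)]$. For $n\ge1$, $C^n_{\mathrm{Hom}}(\mathfrak{g},\mathfrak{g})=\{f:\wedge^n\mathfrak{g}\to\mathfrak{g}\mid\alpha\circ f=f\circ\alpha^{\wedge n}\}$; $C^\bullet_{\mathrm{Hom}}(\mathfrak{g},\mathfrak{g})=\bigoplus_{n\ge1}C^n_{\mathrm{Hom}}(\mathfrak{g},\mathfrak{g})$ with $C^n_{\mathrm{Hom}}$ in degree $n$, while in $C^{\bullet+1}_{\mathrm{Hom}}(\mathfrak{g},\mathfrak{g})$ the summand $C^{n+1}_{\mathrm{Hom}}$ has degree $n\ge0$. $Sh(m,n)$ is the set of $(m,n)$-shuffles. For $P\in C^m_{\mathrm{Hom}}(\mathfrak{g},\mathfrak{g})$, $Q\in C^n_{\mathrm{Hom}}(\mathfrak{g},\mathfrak{g})$: $$(i_PQ)(x_1,\ldots,x_{m+n-1})=\sum_{\sigma\in Sh(m,n-1)}(-1)^\sigma Q\big(P(x_{\sigma(1)},\ldots,x_{\sigma(m)}),\alpha^{m-1}x_{\sigma(m+1)},\ldots,\alpha^{m-1}x_{\sigma(m+n-1)}\big),$$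 $$[P,Q]_{\mathsf{NR}}=i_PQ-(-1)^{(m-1)(n-1)}i_QP,$$ $$[P,Q]_{\mathsf{C}}(x_1,\ldots,x_{m+n})=\sum_{\sigma\in Sh(m,n)}(-1)^\sigma[\alpha^{n-1}P(x_{\sigma(1)},\ldots,x_{\sigma(m)}),\alpha^{m-1}Q(x_{\sigma(m+1)},\ldots,x_{\sigma(m+n)})],$$ $$(\delta_{\mathrm{Hom}}P)(x_1,\ldots,x_{m+1})=\sum_{i=1}^{m+1}(-1)^{i+1}[\alpha^{m-1}(x_i),P(x_1,\ldots,\widehat{x_i},\ldots,x_{m+1})]+\sum_{i<j}(-1)^{i+j}P([x_i,x_j],\alpha(x_1),\ldots,\widehat{\alpha(x_i)},\ldots,\widehat{\alpha(x_j)},\ldots,\alpha(x_{m+1})).$$ The bracket $[~,~]_{\mathsf{NR}}$ makes $C^{\bullet+1}_{\mathrm{Hom}}(\mathfrak{g},\mathfrak{g})$ a graded Lie algebra. The Frölicher-Nijenhuis bracket $[~,~]_{\mathsf{FN}}:C^m_{\mathrm{Hom}}(\mathfrak{g},\mathfrak{g})\times C^n_{\mathrm{Hom}}(\mathfrak{g},\mathfrak{g})\to C^{m+n}_{\mathrm{Hom}}(\mathfrak{g},\mathfrak{g})$, $m,n\ge1$, is $$[P,Q]_{\mathsf{FN}}:=[P,Q]_{\mathsf{C}}+(-1)^m\,i_{(\delta_{\mathrm{Hom}}P)}Q-(-1)^{(m+1)n}\,i_{(\delta_{\mathrm{Hom}}Q)}P.$$ *)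

theory Defs
  imports Complex_Main "HOL-Combinatorics.Permutations" "HOL-Library.Function_Algebras"
begin

section \<open>Graded Lie algebras\<close>

text \<open>
  A graded Lie algebra is an internal direct sum of subspaces \<open>L n\<close> of an ambient vector space,
  with a bracket whose values are only relevant on that sum. The grading is by natural numbers:
  this is a \<open>\<int>\<close>-graded Lie algebra whose components of negative degree vanish.
\<close>

locale graded_lie_algebra = vector_space scale
  for scale :: "'k::field_char_0 \<Rightarrow> 'a::ab_group_add \<Rightarrow> 'a" (infixr \<open>*s\<close> 75) +
  fixes L :: "nat \<Rightarrow> 'a set"
    and brk :: "'a \<Rightarrow> 'a \<Rightarrow> 'a"
  assumes subspace_L: "subspace (L n)"
    and direct: "\<lbrakk>finite I; \<And>n. n \<in> I \<Longrightarrow> u n \<in> L n; (\<Sum>n\<in>I. u n) = 0; i \<in> I\<rbrakk> \<Longrightarrow> u i = 0"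
    and brk_add_left: "\<lbrakk>x \<in> span (\<Union>n. L n); y \<in> span (\<Union>n. L n); z \<in> span (\<Union>n. L n)\<rbrakk>
          \<Longrightarrow> brk (x + y) z = brk x z + brk y z"
    and brk_add_right: "\<lbrakk>x \<in> span (\<Union>n. L n); y \<in> span (\<Union>n. L n); z \<in> span (\<Union>n. L n)\<rbrakk>
          \<Longrightarrow> brk x (y + z) = brk x y + brk x z"
    and brk_scale_left: "\<lbrakk>x \<in> span (\<Union>n. L n); y \<in> span (\<Union>n. L n)\<rbrakk>
          \<Longrightarrow> brk (c *s x) y = c *s brk x y"
    and brk_scale_right: "\<lbrakk>x \<in> span (\<Union>n. L n); y \<in> span (\<Union>n. L n)\<rbrakk>
          \<Longrightarrow> brk x (c *s y) = c *s brk x y"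
    and brk_degree: "\<lbrakk>x \<in> L m; y \<in> L n\<rbrakk> \<Longrightarrow> brk x y \<in> L (m + n)"
    and graded_skew: "\<lbrakk>x \<in> L m; y \<in> L n\<rbrakk> \<Longrightarrow> brk x y = - ((-1) ^ (m * n) *s brk y x)"
    and graded_jacobi: "\<lbrakk>x \<in> L m; y \<in> L n; z \<in> L p\<rbrakk>
          \<Longrightarrow> brk x (brk y z) = brk (brk x y) z + (-1) ^ (m * n) *s brk y (brk x z)"

locale graded_lie_algebra_morphism =
  A: graded_lie_algebra scale1 L1 brk1 + B: graded_lie_algebra scale2 L2 brk2
  for scale1 :: "'k::field_char_0 \<Rightarrow> 'a::ab_group_add \<Rightarrow> 'a"
    and L1 :: "nat \<Rightarrow> 'a set" and brk1 :: "'a \<Rightarrow> 'a \<Rightarrow> 'a"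
    and scale2 :: "'k::field_char_0 \<Rightarrow> 'b::ab_group_add \<Rightarrow> 'b"
    and L2 :: "nat \<Rightarrow> 'b set" and brk2 :: "'b \<Rightarrow> 'b \<Rightarrow> 'b" +
  fixes \<phi> :: "'a \<Rightarrow> 'b"
  assumes map_add: "\<lbrakk>x \<in> A.span (\<Union>n. L1 n); y \<in> A.span (\<Union>n. L1 n)\<rbrakk> \<Longrightarrow> \<phi> (x + y) = \<phi> x + \<phi> y"
    and map_scale: "x \<in> A.span (\<Union>n. L1 n) \<Longrightarrow> \<phi> (scale1 c x) = scale2 c (\<phi> x)"
    and map_degree: "x \<in> L1 n \<Longrightarrow> \<phi> x \<in> L2 n"
    and map_brk: "\<lbrakk>x \<in> A.span (\<Union>n. L1 n); y \<in> A.span (\<Union>n. L1 n)\<rbrakk>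
          \<Longrightarrow> \<phi> (brk1 x y) = brk2 (\<phi> x) (\<phi> y)"


section \<open>Shuffles and homogeneous parts\<close>

text \<open>Indices start at 0: an \<open>(m, n)\<close>-shuffle permutes \<open>{0, \<dots>, m + n - 1}\<close>.\<close>

definition shuffle_perms :: "nat \<Rightarrow> nat \<Rightarrow> (nat \<Rightarrow> nat) set" where
  "shuffle_perms m n = {\<sigma>. \<sigma> permutes {..<m + n} \<and>
     strict_mono_on {..<m} \<sigma> \<and> strict_mono_on {m..<m + n} \<sigma>}"

text \<open>
  An \<open>n\<close>-ary map is a function on lists that vanishes on all lists of length other than \<open>n\<close>.
  Hence the spaces of \<open>n\<close>-ary maps for different \<open>n\<close> form an internal direct sum inside the
  space of all functions on lists (with the pointwise operations), and the \<open>n\<close>-th component of an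
  element of that sum is its restriction to lists of length \<open>n\<close>.
\<close>

definition hpart :: "nat \<Rightarrow> ('v list \<Rightarrow> 'v::ab_group_add) \<Rightarrow> 'v list \<Rightarrow> 'v" where
  "hpart n f = (\<lambda>xs. if length xs = n then f xs else 0)"

text \<open>Extension of an operation on homogeneous elements (given for each degree, or for each pair
  of degrees) to finite sums of homogeneous elements.\<close>

definition extend1 ::
  "(nat \<Rightarrow> ('v list \<Rightarrow> 'v) \<Rightarrow> 'v list \<Rightarrow> 'v)
    \<Rightarrow> ('v list \<Rightarrow> 'v::ab_group_add) \<Rightarrow> 'v list \<Rightarrow> 'v" where
  "extend1 D f = (\<Sum>m | hpart m f \<noteq> 0. D m (hpart m f))"

definition extend2 ::
  "(nat \<Rightarrow> nat \<Rightarrow> ('v list \<Rightarrow> 'v) \<Rightarrow> ('v list \<Rightarrow> 'v) \<Rightarrow> 'v list \<Rightarrow> 'v)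
    \<Rightarrow> ('v list \<Rightarrow> 'v::ab_group_add) \<Rightarrow> ('v list \<Rightarrow> 'v) \<Rightarrow> 'v list \<Rightarrow> 'v" where
  "extend2 B f g = (\<Sum>m | hpart m f \<noteq> 0. \<Sum>n | hpart n g \<noteq> 0. B m n (hpart m f) (hpart n g))"


section \<open>Hom-Lie algebras and their cochains\<close>

locale hom_lie_algebra = vector_space scale
  for scale :: "'k::field_char_0 \<Rightarrow> 'v::ab_group_add \<Rightarrow> 'v" (infixr \<open>*s\<close> 75) +
  fixes lie :: "'v \<Rightarrow> 'v \<Rightarrow> 'v"
    and \<alpha> :: "'v \<Rightarrow> 'v"
  assumes lie_linear_left: "Vector_Spaces.linear scale scale (\<lambda>x. lie x y)"
    and lie_linear_right: "Vector_Spaces.linear scale scale (\<lambda>y. lie x y)"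
    and lie_skew: "lie x y = - lie y x"
    and alpha_linear: "Vector_Spaces.linear scale scale \<alpha>"
    and hom_jacobi: "lie (\<alpha> x) (lie y z) + lie (\<alpha> y) (lie z x) + lie (\<alpha> z) (lie x y) = 0"
    and alpha_lie: "\<alpha> (lie x y) = lie (\<alpha> x) (\<alpha> y)"
begin

definition cscale :: "'k \<Rightarrow> ('v list \<Rightarrow> 'v) \<Rightarrow> 'v list \<Rightarrow> 'v" where
  "cscale c f = (\<lambda>xs. c *s f xs)"

text \<open>Linear maps on the \<open>n\<close>-th exterior power are alternating \<open>n\<close>-linear maps.\<close>

definition cochains :: "nat \<Rightarrow> ('v list \<Rightarrow> 'v) set" where
  "cochains n = {f.
     (\<forall>xs. length xs \<noteq> n \<longrightarrow> f xs = 0) \<and>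
     (\<forall>xs i. length xs = n \<and> i < n \<longrightarrow> Vector_Spaces.linear scale scale (\<lambda>x. f (xs[i := x]))) \<and>
     (\<forall>xs i j. length xs = n \<and> i < j \<and> j < n \<and> xs ! i = xs ! j \<longrightarrow> f xs = 0) \<and>
     (\<forall>xs. length xs = n \<longrightarrow> \<alpha> (f xs) = f (map \<alpha> xs))}"

text \<open>The degree \<open>n\<close> components of the cochain space, where \<open>n\<close>-ary maps have degree \<open>n \<ge> 1\<close>, and
  of its shift, where \<open>(n + 1)\<close>-ary maps have degree \<open>n \<ge> 0\<close>.\<close>

definition C_Hom :: "nat \<Rightarrow> ('v list \<Rightarrow> 'v) set" where
  "C_Hom n = (if n \<ge> 1 then cochains n else {0})"

definition C_Hom_shift :: "nat \<Rightarrow> ('v list \<Rightarrow> 'v) set" where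
  "C_Hom_shift n = cochains (n + 1)"

text \<open>In the following operations \<open>m\<close> and \<open>n\<close> are the arities of \<open>P\<close> and \<open>Q\<close>.\<close>

definition ins :: "nat \<Rightarrow> nat \<Rightarrow> ('v list \<Rightarrow> 'v) \<Rightarrow> ('v list \<Rightarrow> 'v) \<Rightarrow> 'v list \<Rightarrow> 'v" where
  "ins m n P Q = (\<lambda>xs. if length xs = m + n - 1 then
     (\<Sum>\<sigma>\<in>shuffle_perms m (n - 1). of_int (sign \<sigma>) *s
        Q (P (map (\<lambda>i. xs ! \<sigma> i) [0..<m]) #
           map (\<lambda>i. (\<alpha> ^^ (m - 1)) (xs ! \<sigma> i)) [m..<m + n - 1]))
     else 0)"

definition NR_hom :: "nat \<Rightarrow> nat \<Rightarrow> ('v list \<Rightarrow> 'v) \<Rightarrow> ('v list \<Rightarrow> 'v) \<Rightarrow> 'v list \<Rightarrow> 'v" where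
  "NR_hom m n P Q = ins m n P Q - cscale ((-1) ^ ((m - 1) * (n - 1))) (ins n m Q P)"

definition C_bracket :: "nat \<Rightarrow> nat \<Rightarrow> ('v list \<Rightarrow> 'v) \<Rightarrow> ('v list \<Rightarrow> 'v) \<Rightarrow> 'v list \<Rightarrow> 'v" where
  "C_bracket m n P Q = (\<lambda>xs. if length xs = m + n then
     (\<Sum>\<sigma>\<in>shuffle_perms m n. of_int (sign \<sigma>) *s
        lie ((\<alpha> ^^ (n - 1)) (P (map (\<lambda>i. xs ! \<sigma> i) [0..<m])))
            ((\<alpha> ^^ (m - 1)) (Q (map (\<lambda>i. xs ! \<sigma> i) [m..<m + n]))))
     else 0)"

text \<open>With indices starting at 0, the sign \<open>(-1)^(i+1)\<close> becomes \<open>(-1)^i\<close>, while \<open>(-1)^(i+j)\<close> is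
  unchanged. The list \<open>nths xs (- I)\<close> is \<open>xs\<close> with the entries at positions in \<open>I\<close> omitted.\<close>

definition delta_hom :: "nat \<Rightarrow> ('v list \<Rightarrow> 'v) \<Rightarrow> 'v list \<Rightarrow> 'v" where
  "delta_hom m P = (\<lambda>xs. if length xs = m + 1 then
     (\<Sum>i<m + 1. (-1) ^ i *s lie ((\<alpha> ^^ (m - 1)) (xs ! i)) (P (nths xs (- {i})))) +
     (\<Sum>(i, j)\<in>{(i, j). i < j \<and> j < m + 1}. (-1) ^ (i + j) *s
        P (lie (xs ! i) (xs ! j) # map \<alpha> (nths xs (- {i, j}))))
     else 0)"

definition FN_hom :: "nat \<Rightarrow> nat \<Rightarrow> ('v list \<Rightarrow> 'v) \<Rightarrow> ('v list \<Rightarrow> 'v) \<Rightarrow> 'v list \<Rightarrow> 'v" where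
  "FN_hom m n P Q = C_bracket m n P Q
     + cscale ((-1) ^ m) (ins (m + 1) n (delta_hom m P) Q)
     - cscale ((-1) ^ ((m + 1) * n)) (ins (n + 1) m (delta_hom n Q) P)"

definition NR_bracket :: "('v list \<Rightarrow> 'v) \<Rightarrow> ('v list \<Rightarrow> 'v) \<Rightarrow> 'v list \<Rightarrow> 'v" where
  "NR_bracket = extend2 NR_hom"

definition FN_bracket :: "('v list \<Rightarrow> 'v) \<Rightarrow> ('v list \<Rightarrow> 'v) \<Rightarrow> 'v list \<Rightarrow> 'v" where
  "FN_bracket = extend2 FN_hom"

definition delta_Hom :: "('v list \<Rightarrow> 'v) \<Rightarrow> 'v list \<Rightarrow> 'v" where
  "delta_Hom = extend1 delta_hom"

end

end

theory Submission
  imports Defs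
begin

text \<open>
  Everything reduces to the insertion \<open>i\<^sub>P Q\<close>. It is a graded pre-Lie product: in
  \<open>i\<^sub>P (i\<^sub>Q R) - i\<^bsub>i\<^sub>P Q\<^esub> R\<close> only the terms survive that put \<open>P\<close> and \<open>Q\<close> into two different
  arguments of \<open>R\<close>, and these are graded symmetric in \<open>P\<close> and \<open>Q\<close> (\<open>iota_iota\<close>,
  \<open>iota_commutator\<close>). So \<open>P \<mapsto> i\<^sub>P\<close> turns the Nijenhuis-Richardson bracket into the graded
  commutator, which gives the Jacobi identity for that bracket (\<open>NR_op_jacobi\<close>). The Lie bracket is
  a binary cochain \<open>\<mu>\<close> with \<open>i\<^sub>\<mu> \<mu> = 0\<close>, by the Hom-Jacobi identity, and
  \<open>\<delta> P = - [\<mu>, P]\<close> in the Nijenhuis-Richardson algebra. Hence \<open>\<delta>\<close> is a derivation of square zero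
  (\<open>coboundary_NR_op\<close>, \<open>coboundary_coboundary\<close>).

  For \<open>R = \<mu>\<close> the surviving terms are exactly the cup bracket \<open>[P, Q]\<^sub>C\<close>, up to sign
  (\<open>iota_iota_lie\<close>). This turns the defect of \<open>i\<^sub>P\<close> from commuting with \<open>\<delta>\<close> into
  \<open>[P, Q]\<^sub>C \<plusminus> i\<^bsub>\<delta> P\<^esub> Q\<close> (\<open>iota_coboundary\<close>), so that, for \<open>P\<close> of arity \<open>m\<close>,
  \<open>[P, Q]\<^sub>F\<^sub>N = [P, \<delta> Q]\<^sub>N\<^sub>R + (-1)\<^sup>m \<delta> (i\<^sub>P Q)\<close> (\<open>FN_op_eq_NR_op_coboundary\<close>). Applying \<open>\<delta>\<close>
  gives \<open>\<delta> [P, Q]\<^sub>F\<^sub>N = [\<delta> P, \<delta> Q]\<^sub>N\<^sub>R\<close>, the morphism property.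

  The Jacobi identity for the Froelicher-Nijenhuis bracket does not follow from this, because
  \<open>\<delta>\<close> need not be injective. Instead each double bracket is expanded (\<open>FN_op_FN_op\<close>). The
  morphism property and the commutator formula split \<open>i\<^bsub>\<delta> [Q, R]\<^esub>\<close> into double insertions, and
  since insertions are derivations of the cup bracket (\<open>iota_cup\<close>), all terms become
  \<open>[P, [Q, R]\<^sub>C]\<^sub>C\<close>, \<open>[P, i\<^bsub>\<delta> Q\<^esub> R]\<^sub>C\<close> or \<open>i\<^bsub>\<delta> P\<^esub> (i\<^bsub>\<delta> Q\<^esub> R)\<close>. The first kind cancels
  by the Jacobi identity for the cup bracket, the other two term by term.

  Sums over shuffles are handled as sums over the ways to split a list into two complementary
  subsequences, defined by recursion on the list (\<open>unshuffle_sum\<close>). The combinatorics that the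
  identities above need is then just coassociativity and graded cocommutativity of this splitting,
  both of which are short inductions.
\<close>

section \<open>Signed sums over unshuffles of a list\<close>

text \<open>
  The sign \<open>(-1)\<^sup>k\<close> as an operation on any abelian group, so that the signed sums below make
  sense without a scalar field and signs become a matter of parity.
\<close>

definition sign_act :: "nat \<Rightarrow> 'a \<Rightarrow> 'a::ab_group_add" where
  "sign_act k v = (if even k then v else - v)"

lemma sign_act_0 [simp]: "sign_act k 0 = 0"
  by (simp add: sign_act_def)

lemma sign_act_sign_act: "sign_act j (sign_act k v) = sign_act (j + k) v"
  by (simp add: sign_act_def)

lemma sign_act_parity: "even j = even k \<Longrightarrow> sign_act j v = sign_act k v"
  by (simp add: sign_act_def)

lemma sign_act_add: "sign_act k (v + w) = sign_act k v + sign_act k w"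
  by (simp add: sign_act_def)

lemma sign_act_apply: "sign_act k f x = sign_act k (f x)"
  by (simp add: sign_act_def)

text \<open>
  The sum of \<open>\<plusminus> F as bs\<close> over all splittings of a list into complementary subsequences \<open>as\<close> and
  \<open>bs\<close>, with the sign of the permutation that maps the list to \<open>as @ bs\<close>: moving the head
  of the list in front of \<open>bs\<close> means passing all of \<open>as\<close>. In terms of the exterior algebra this is
  the unshuffle coproduct followed by \<open>F\<close>. No lengths are prescribed: the cochains to which it is
  applied vanish on lists of the wrong length and so select the \<open>(m, n)\<close>-unshuffles.
\<close>

fun unshuffle_sum :: "'x list \<Rightarrow> ('x list \<Rightarrow> 'x list \<Rightarrow> 'b) \<Rightarrow> 'b::ab_group_add" where
  "unshuffle_sum [] F = F [] []"
| "unshuffle_sum (x # xs) F =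
     unshuffle_sum xs (\<lambda>as bs. F (x # as) bs) + unshuffle_sum xs (\<lambda>as bs. sign_act (length as) (F as (x # bs)))"

lemma unshuffle_sum_cong:
  assumes "\<And>as bs. length as + length bs = length xs \<Longrightarrow> F as bs = G as bs"
  shows "unshuffle_sum xs F = unshuffle_sum xs G"
  using assms
proof (induction xs arbitrary: F G)
  case (Cons x xs)
  have "unshuffle_sum xs (\<lambda>as bs. F (x # as) bs) = unshuffle_sum xs (\<lambda>as bs. G (x # as) bs)"
    by (rule Cons.IH) (simp add: Cons.prems)
  moreover have "unshuffle_sum xs (\<lambda>as bs. sign_act (length as) (F as (x # bs))) =
      unshuffle_sum xs (\<lambda>as bs. sign_act (length as) (G as (x # bs)))"
    by (rule Cons.IH) (simp add: Cons.prems)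
  ultimately show ?case by simp
qed simp

lemma unshuffle_sum_add: "unshuffle_sum xs (\<lambda>as bs. F as bs + G as bs) = unshuffle_sum xs F + unshuffle_sum xs G"
  by (induction xs arbitrary: F G) (simp_all add: sign_act_add)

lemma unshuffle_sum_additive:
  assumes "\<And>v w. h (v + w) = h v + h w"
  shows "h (unshuffle_sum xs F) = unshuffle_sum xs (\<lambda>as bs. h (F as bs))"
proof (induction xs arbitrary: F)
  case (Cons x xs)
  interpret additive h by unfold_locales (rule assms)
  have "h (sign_act k v) = sign_act k (h v)" for k v by (simp add: sign_act_def minus)
  then show ?case by (simp add: Cons.IH assms)
qed simp

lemma unshuffle_sum_sign_act: "unshuffle_sum xs (\<lambda>as bs. sign_act k (F as bs)) = sign_act k (unshuffle_sum xs F)"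
  by (rule unshuffle_sum_additive[symmetric]) (rule sign_act_add)

lemma unshuffle_sum_minus: "unshuffle_sum xs (\<lambda>as bs. - F as bs) = - unshuffle_sum xs F"
  using unshuffle_sum_sign_act[of xs 1 F] by (simp add: sign_act_def)

lemma unshuffle_sum_zero [simp]: "unshuffle_sum xs (\<lambda>as bs. 0) = 0"
  by (induction xs) simp_all

lemma unshuffle_sum_eq_0:
  assumes "\<And>as bs. length as + length bs = length xs \<Longrightarrow> F as bs = 0"
  shows "unshuffle_sum xs F = 0"
  using unshuffle_sum_cong[of xs F "\<lambda>as bs. 0"] assms by simp

lemma unshuffle_sum_map: "unshuffle_sum (map f xs) F = unshuffle_sum xs (\<lambda>as bs. F (map f as) (map f bs))"
  by (induction xs arbitrary: F) simp_all

text \<open>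
  Both sides sum over splittings into three subsequences; the signs agree because the
  number of inversions between two blocks is additive in each of the blocks.
\<close>

lemma unshuffle_sum_coassoc:
  "unshuffle_sum xs (\<lambda>as us. unshuffle_sum us (\<lambda>bs cs. G as bs cs)) = unshuffle_sum xs (\<lambda>us cs. unshuffle_sum us (\<lambda>as bs. G as bs cs))"
proof (induction xs arbitrary: G)
  case (Cons x xs)
  have "unshuffle_sum xs (\<lambda>us cs. sign_act (length us) (unshuffle_sum us (\<lambda>as bs. G as bs (x # cs)))) =
      unshuffle_sum xs (\<lambda>us cs. unshuffle_sum us (\<lambda>as bs. sign_act (length as + length bs) (G as bs (x # cs))))"
    by (intro unshuffle_sum_cong) (auto simp: unshuffle_sum_sign_act[symmetric] intro: unshuffle_sum_cong)
  then show ?case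
    by (simp add: Cons.IH unshuffle_sum_add sign_act_add unshuffle_sum_sign_act[symmetric] sign_act_sign_act)
qed simp

text \<open>
  Exchanging the blocks \<open>as\<close> and \<open>bs\<close> changes the sign by one transposition for each pair of
  entries.
\<close>

lemma unshuffle_sum_cocomm:
  fixes F :: "'x list \<Rightarrow> 'x list \<Rightarrow> 'b::ab_group_add"
  shows "unshuffle_sum xs F = unshuffle_sum xs (\<lambda>bs as. sign_act (length as * length bs) (F as bs))"
proof (induction xs arbitrary: F)
  case (Cons x xs)
  have *: "sign_act (length (bs :: 'x list)) (sign_act (length (x # as) * length bs) v) = sign_act (length as * length bs) v"
    for as bs and v :: 'b
    unfolding sign_act_sign_act by (rule sign_act_parity) auto
  have **: "sign_act (length (as :: 'x list) * length (x # bs)) v = sign_act (length as * length bs) (sign_act (length as) v)"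
    for as bs and v :: 'b
    unfolding sign_act_sign_act by (rule sign_act_parity) auto
  have "unshuffle_sum (x # xs) F = unshuffle_sum xs (\<lambda>bs as. sign_act (length as * length bs) (F (x # as) bs)) +
      unshuffle_sum xs (\<lambda>bs as. sign_act (length as * length bs) (sign_act (length as) (F as (x # bs))))"
    unfolding unshuffle_sum.simps by (intro arg_cong2[where f = "(+)"] Cons.IH)
  then show ?case by (simp only: unshuffle_sum.simps * ** add.commute)
qed (simp add: sign_act_def)

lemma unshuffle_sum_swap:
  "unshuffle_sum xs (\<lambda>as us. unshuffle_sum us (\<lambda>bs cs. G as bs cs)) =
   unshuffle_sum xs (\<lambda>bs us. unshuffle_sum us (\<lambda>as cs. sign_act (length as * length bs) (G as bs cs)))"
  unfolding unshuffle_sum_coassoc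
  by (subst unshuffle_sum_cocomm) (rule refl)

text \<open>
  If two adjacent entries of the list are equal, the splittings that separate them cancel in
  pairs, and the others contribute 0 by assumption. Adjacent entries suffice for alternation of
  multilinear maps, see \<open>adjacent_alternating_imp_alternating\<close> below.
\<close>

lemma unshuffle_sum_alternating:
  fixes F :: "'x list \<Rightarrow> 'x list \<Rightarrow> 'b::ab_group_add"
  assumes "\<And>pre x post bs. F (pre @ x # x # post) bs = 0"
    and "\<And>as pre x post. F as (pre @ x # x # post) = 0"
  shows "unshuffle_sum (pre @ x # x # post) F = 0"
  using assms
proof (induction pre arbitrary: F)
  case Nil
  have "unshuffle_sum post (\<lambda>as bs. F (x # x # as) bs) = 0"
    "unshuffle_sum post (\<lambda>as bs. sign_act (length as) (sign_act (length as) (F as (x # x # bs)))) = 0"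
    using Nil(1)[of "[]"] Nil(2)[of _ "[]"] by simp_all
  moreover have "sign_act (length (x # as)) v = - sign_act (length as) v" for as and v :: 'b
    by (simp add: sign_act_def)
  ultimately show ?case by (simp add: unshuffle_sum_minus del: length_Cons)
next
  case (Cons y pre)
  have "unshuffle_sum (pre @ x # x # post) (\<lambda>as bs. F (y # as) bs) = 0"
    using Cons.prems(1)[of "y # _"] Cons.prems(2) by (intro Cons.IH) simp_all
  moreover have "unshuffle_sum (pre @ x # x # post) (\<lambda>as bs. sign_act (length as) (F as (y # bs))) = 0"
    using Cons.prems(2)[of _ "y # _"] Cons.prems(1) by (intro Cons.IH) simp_all
  ultimately show ?case by simp
qed

section \<open>Sums over shuffle permutations\<close>

text \<open>
  A shuffle of \<open>m + n\<close> indices sends either the index 0 or the index \<open>m\<close> to 0, because its two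
  increasing blocks start there. In the first case it is \<open>lift_perm \<tau>\<close> and in the second
  \<open>lift_perm \<tau> \<circ> front_cycle m\<close> for a shuffle \<open>\<tau>\<close> of one index fewer. This is the recursion
  that defines \<open>unshuffle_sum\<close>: the head of the list goes to the first or to the second block,
  where the cycle has sign \<open>(-1)\<^sup>m\<close>.
\<close>

definition lift_perm :: "(nat \<Rightarrow> nat) \<Rightarrow> nat \<Rightarrow> nat" where
  "lift_perm \<sigma> = (\<lambda>i. case i of 0 \<Rightarrow> 0 | Suc j \<Rightarrow> Suc (\<sigma> j))"

definition front_cycle :: "nat \<Rightarrow> nat \<Rightarrow> nat" where
  "front_cycle m = (\<lambda>i. if i < m then Suc i else if i = m then 0 else i)"

lemma lift_perm_simps [simp]: "lift_perm \<sigma> 0 = 0" "lift_perm \<sigma> (Suc i) = Suc (\<sigma> i)"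
  by (simp_all add: lift_perm_def)

lemma inj_lift_perm: "inj lift_perm"
proof (rule injI, rule ext)
  fix \<sigma> \<tau> i assume "lift_perm \<sigma> = lift_perm \<tau>"
  then have "lift_perm \<sigma> (Suc i) = lift_perm \<tau> (Suc i)" by simp
  then show "\<sigma> i = \<tau> i" by simp
qed

lemma lift_perm_transpose: "lift_perm (transpose a b) = transpose (Suc a) (Suc b)"
  by (auto simp: fun_eq_iff lift_perm_def transpose_def split: nat.splits)

lemma lift_perm_comp: "lift_perm (\<sigma> \<circ> \<tau>) = lift_perm \<sigma> \<circ> lift_perm \<tau>"
  by (auto simp: fun_eq_iff lift_perm_def split: nat.splits)

lemma lift_perm_permutes_sign:
  assumes "\<sigma> permutes {..<N}"
  shows "lift_perm \<sigma> permutes {..<Suc N} \<and> sign (lift_perm \<sigma>) = sign \<sigma>"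
  using assms finite_lessThan
proof (induction rule: permutes_induct)
  case id
  have "lift_perm id = id" by (auto simp: fun_eq_iff lift_perm_def split: nat.splits)
  then show ?case using permutes_id[of "{..<Suc N}"] by (simp add: id_def)
next
  case (swap a b p)
  have t: "transpose (Suc a) (Suc b) permutes {..<Suc N}"
    using swap by (intro permutes_swap_id) auto
  have "permutation p" "permutation (lift_perm p)"
    using swap finite_lessThan permutation_permutes by blast+
  then have "sign (lift_perm (transpose a b \<circ> p)) = sign (transpose a b \<circ> p)"
    unfolding lift_perm_comp lift_perm_transpose
    using swap by (simp add: sign_compose permutation_swap_id sign_swap_id)
  with t swap show ?case
    unfolding lift_perm_comp lift_perm_transpose by (blast intro: permutes_compose)
qed

lemma front_cycle_permutes_sign:
  "m < N \<Longrightarrow> front_cycle m permutes {..<N} \<and> sign (front_cycle m) = (-1) ^ m"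
proof (induction m)
  case 0
  have "front_cycle 0 = id" by (auto simp: front_cycle_def)
  then show ?case using permutes_id[of "{..<N}"] by (simp add: id_def)
next
  case (Suc m)
  \<comment> \<open>One more adjacent transposition, hence one more sign.\<close>
  have eq: "front_cycle (Suc m) = front_cycle m \<circ> transpose m (Suc m)"
    by (auto simp: fun_eq_iff front_cycle_def transpose_def)
  have t: "transpose m (Suc m) permutes {..<N}"
    using Suc by (intro permutes_swap_id) auto
  have "front_cycle m permutes {..<N}" "sign (front_cycle m) = (-1) ^ m" using Suc by auto
  moreover from this have "permutation (front_cycle m)"
    using finite_lessThan permutation_permutes by blast
  ultimately show ?case
    unfolding eq using t permutes_compose[of "transpose m (Suc m)" "{..<N}" "front_cycle m"]
    by (simp add: sign_compose permutation_swap_id sign_swap_id del: comp_apply o_def)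
qed

lemma fix_0_imp_lift_perm:
  assumes "\<rho> permutes {..<Suc N}" "\<rho> 0 = 0"
  obtains \<tau> where "\<tau> permutes {..<N}" "\<rho> = lift_perm \<tau>"
proof
  define \<tau> where "\<tau> i = \<rho> (Suc i) - 1" for i
  have inj: "inj \<rho>" using assms(1) by (rule permutes_inj)
  have pos: "\<rho> (Suc i) > 0" for i
    using inj assms(2) by (metis gr0I injD nat.distinct(1))
  have S: "\<rho> (Suc i) = Suc (\<tau> i)" for i using pos[of i] by (simp add: \<tau>_def)
  show "\<rho> = lift_perm \<tau>"
    using S assms(2) by (auto simp: fun_eq_iff lift_perm_def split: nat.splits)
  have "inj \<tau>"
    using inj S by (metis (no_types, lifting) Suc_inject injD injI)
  moreover have "\<tau> ` {..<N} \<subseteq> {..<N}"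
  proof safe
    fix i assume "i < N"
    then have "\<rho> (Suc i) \<in> {..<Suc N}"
      using permutes_in_image[OF assms(1), of "Suc i"] by simp
    then show "\<tau> i < N" using S by simp
  qed
  ultimately have "bij_betw \<tau> {..<N} {..<N}"
    unfolding bij_betw_def using endo_inj_surj[of "{..<N}" \<tau>] inj_on_subset[of \<tau> UNIV] by auto
  moreover have "\<tau> i = i" if "i \<notin> {..<N}" for i
    using permutes_not_in[OF assms(1), of "Suc i"] S[of i] that by simp
  ultimately show "\<tau> permutes {..<N}" by (intro bij_imp_permutes)
qed

lemma shuffle_first_left:
  "{\<sigma> \<in> shuffle_perms (Suc m) n. \<sigma> 0 = 0} = lift_perm ` shuffle_perms m n" (is "?A = ?B")
proof
  show "?A \<subseteq> ?B"
  proof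
    fix \<sigma> assume "\<sigma> \<in> ?A"
    then have s: "\<sigma> permutes {..<Suc (m + n)}" "\<sigma> 0 = 0" "strict_mono_on {..<Suc m} \<sigma>"
      "strict_mono_on {Suc m..<Suc (m + n)} \<sigma>" by (auto simp: shuffle_perms_def)
    obtain \<tau> where t: "\<tau> permutes {..<m + n}" "\<sigma> = lift_perm \<tau>"
      using fix_0_imp_lift_perm s by metis
    have "strict_mono_on {..<m} \<tau>" "strict_mono_on {m..<m + n} \<tau>"
    proof -
      show "strict_mono_on {..<m} \<tau>"
      proof (rule strict_mono_onI)
        fix r s' assume "r \<in> {..<m}" "s' \<in> {..<m}" "r < s'"
        then show "\<tau> r < \<tau> s'" using strict_mono_onD[OF s(3), of "Suc r" "Suc s'"] t by simp
      qed
      show "strict_mono_on {m..<m + n} \<tau>"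
      proof (rule strict_mono_onI)
        fix r s' assume "r \<in> {m..<m+n}" "s' \<in> {m..<m+n}" "r < s'"
        then show "\<tau> r < \<tau> s'" using strict_mono_onD[OF s(4), of "Suc r" "Suc s'"] t by simp
      qed
    qed
    with t show "\<sigma> \<in> ?B" by (auto simp: shuffle_perms_def)
  qed
  show "?B \<subseteq> ?A"
  proof
    fix \<sigma> assume "\<sigma> \<in> ?B"
    then obtain \<tau> where t: "\<sigma> = lift_perm \<tau>" "\<tau> permutes {..<m + n}" "strict_mono_on {..<m} \<tau>"
      "strict_mono_on {m..<m + n} \<tau>" by (auto simp: shuffle_perms_def)
    have "strict_mono_on {..<Suc m} \<sigma>" "strict_mono_on {Suc m..<Suc (m + n)} \<sigma>"
      using t(3,4) by (auto simp: t(1) strict_mono_on_def lift_perm_def split: nat.splits)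
    with lift_perm_permutes_sign[OF t(2)] show "\<sigma> \<in> ?A" by (auto simp: t(1) shuffle_perms_def)
  qed
qed

lemma lift_perm_front_cycle:
  "(lift_perm \<tau> \<circ> front_cycle m) i =
     (if i < m then Suc (\<tau> i) else if i = m then 0 else Suc (\<tau> (i - 1)))"
  by (cases i) (auto simp: front_cycle_def)

lemma shuffle_first_right:
  "{\<sigma> \<in> shuffle_perms m (Suc n). \<sigma> m = 0} =
     (\<lambda>\<tau>. lift_perm \<tau> \<circ> front_cycle m) ` shuffle_perms m n" (is "?A = ?B")
proof
  have c: "front_cycle m permutes {..<Suc (m + n)}"
    using front_cycle_permutes_sign[of m "Suc (m + n)"] by simp
  have cm: "front_cycle m m = 0" by (simp add: front_cycle_def)
  show "?A \<subseteq> ?B"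
  proof
    fix \<sigma> assume "\<sigma> \<in> ?A"
    then have s: "\<sigma> permutes {..<Suc (m + n)}" "\<sigma> m = 0" "strict_mono_on {..<m} \<sigma>"
      "strict_mono_on {m..<Suc (m + n)} \<sigma>" by (auto simp: shuffle_perms_def)
    have "(\<sigma> \<circ> inv (front_cycle m)) 0 = 0"
      using cm s(2) c by (metis comp_apply permutes_inv_eq)
    moreover have "\<sigma> \<circ> inv (front_cycle m) permutes {..<Suc (m + n)}"
      using permutes_inv[OF c] s(1) by (rule permutes_compose)
    ultimately obtain \<tau> where t: "\<tau> permutes {..<m + n}" "\<sigma> \<circ> inv (front_cycle m) = lift_perm \<tau>"
      using fix_0_imp_lift_perm by metis
    have e: "\<sigma> = lift_perm \<tau> \<circ> front_cycle m"
      unfolding t(2)[symmetric] using permutes_inv_o(2)[OF c] by (simp add: o_assoc[symmetric])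
    have "strict_mono_on {..<m} \<tau>"
    proof (rule strict_mono_onI)
      fix r s' assume "r \<in> {..<m}" "s' \<in> {..<m}" "r < s'"
      then show "\<tau> r < \<tau> s'"
        using strict_mono_onD[OF s(3), of r s'] lift_perm_front_cycle[of \<tau> m] by (simp add: e)
    qed
    moreover have "strict_mono_on {m..<m + n} \<tau>"
    proof (rule strict_mono_onI)
      fix r s' assume "r \<in> {m..<m+n}" "s' \<in> {m..<m+n}" "r < s'"
      then show "\<tau> r < \<tau> s'"
        using strict_mono_onD[OF s(4), of "Suc r" "Suc s'"] lift_perm_front_cycle[of \<tau> m] by (simp add: e)
    qed
    ultimately show "\<sigma> \<in> ?B" using t(1) e by (auto simp: shuffle_perms_def)
  qed
  show "?B \<subseteq> ?A"
  proof
    fix \<sigma> assume "\<sigma> \<in> ?B"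
    then obtain \<tau> where t: "\<sigma> = lift_perm \<tau> \<circ> front_cycle m" "\<tau> permutes {..<m + n}"
      "strict_mono_on {..<m} \<tau>" "strict_mono_on {m..<m + n} \<tau>" by (auto simp: shuffle_perms_def)
    have "strict_mono_on {..<m} \<sigma>"
      using t(3) by (auto simp: t(1) strict_mono_on_def lift_perm_front_cycle simp del: comp_apply)
    moreover have "strict_mono_on {m..<Suc (m + n)} \<sigma>"
    proof (rule strict_mono_onI)
      fix r s' assume "r \<in> {m..<Suc (m+n)}" "s' \<in> {m..<Suc (m+n)}" "r < s'"
      then show "\<sigma> r < \<sigma> s'"
        using strict_mono_onD[OF t(4), of "r - 1" "s' - 1"]
        by (cases "r = m") (auto simp: t(1) lift_perm_front_cycle simp del: comp_apply)
    qed
    moreover have "\<sigma> permutes {..<Suc (m + n)}"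
      unfolding t(1) using c lift_perm_permutes_sign[OF t(2)] by (auto intro: permutes_compose)
    moreover have "\<sigma> m = 0" by (simp add: t(1) cm)
    ultimately show "\<sigma> \<in> ?A" by (auto simp: shuffle_perms_def)
  qed
qed

lemma shuffle_first_cases:
  assumes "\<sigma> \<in> shuffle_perms m n" "0 < m + n"
  shows "(0 < m \<and> \<sigma> 0 = 0) \<noteq> (0 < n \<and> \<sigma> m = 0)"
proof -
  from assms(1) have s: "\<sigma> permutes {..<m + n}" "strict_mono_on {..<m} \<sigma>"
    "strict_mono_on {m..<m + n} \<sigma>" by (auto simp: shuffle_perms_def)
  obtain i where i: "\<sigma> i = 0" using permutes_surj[OF s(1)] by (metis surjD)
  have lt: "i < m + n" using permutes_in_image[OF s(1), of i] i assms(2) by simp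
  have inj: "\<sigma> a = \<sigma> b \<longleftrightarrow> a = b" for a b using permutes_inj[OF s(1)] by (simp add: inj_eq)
  show ?thesis
  proof (cases "i < m")
    case True
    then have "i = 0" using strict_mono_onD[OF s(2), of 0 i] i by (metis gr0I lessThan_iff not_less_zero order.strict_trans)
    then show ?thesis using True i inj[of 0 m] by auto
  next
    case False
    then have "i = m" using strict_mono_onD[OF s(3), of m i] i lt by (cases "i = m") auto
    then show ?thesis using lt i inj[of 0 m] by auto
  qed
qed

lemma finite_shuffle_perms: "finite (shuffle_perms m n)"
  by (rule finite_subset[OF _ finite_permutations[of "{..<m + n}"]]) (auto simp: shuffle_perms_def)

lemma map_upt_Suc_front: "map f [0..<Suc m] = f 0 # map (\<lambda>i. f (Suc i)) [0..<m]"
  by (simp add: upt_conv_Cons map_Suc_upt[symmetric] del: upt_Suc)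

lemma map_upt_shift: "map f [Suc m..<Suc n] = map (\<lambda>i. f (Suc i)) [m..<n]"
  by (simp add: map_Suc_upt[symmetric] del: upt_Suc)

context vector_space
begin

lemma scale_sign_sign_act: "of_int ((-1) ^ k) *s v = sign_act k v"
  by (cases "even k") (simp_all add: sign_act_def)

lemma scale_sign_act: "c *s sign_act k v = sign_act k (c *s v)"
  by (simp add: sign_act_def)

text \<open>
  The bridge from the sum over shuffle permutations to the recursive sum. It is stated for
  arbitrary \<open>F\<close>, so the recursion needs the test on the lengths of the two blocks.
\<close>

lemma shuffle_sum_eq_unshuffle_sum:
  assumes "length xs = m + n"
  shows "(\<Sum>\<sigma>\<in>shuffle_perms m n. of_int (sign \<sigma>) *s
            F (map (\<lambda>i. xs ! \<sigma> i) [0..<m]) (map (\<lambda>i. xs ! \<sigma> i) [m..<m + n])) =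
         unshuffle_sum xs (\<lambda>as bs. if length as = m \<and> length bs = n then F as bs else 0)"
  using assms
proof (induction xs arbitrary: m n F)
  case Nil
  then have "shuffle_perms m n = {id}" by (auto simp: shuffle_perms_def permutes_id strict_mono_on_def)
  then show ?case using Nil by simp
next
  case (Cons x xs)
  let ?T = "\<lambda>\<sigma>. of_int (sign \<sigma>) *s
            F (map (\<lambda>i. (x # xs) ! \<sigma> i) [0..<m]) (map (\<lambda>i. (x # xs) ! \<sigma> i) [m..<m + n])"
  let ?A = "{\<sigma> \<in> shuffle_perms m n. 0 < m \<and> \<sigma> 0 = 0}"
  let ?B = "{\<sigma> \<in> shuffle_perms m n. 0 < n \<and> \<sigma> m = 0}"
  have len: "Suc (length xs) = m + n" using Cons.prems by simp
  have "0 < m + n" using len by presburger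
  note first = shuffle_first_cases[OF _ this]
  have "shuffle_perms m n = ?A \<union> ?B"
  proof (intro equalityI subsetI)
    fix \<sigma> assume "\<sigma> \<in> shuffle_perms m n"
    then show "\<sigma> \<in> ?A \<union> ?B" using first[of \<sigma>] by simp linarith
  qed auto
  moreover have "?A \<inter> ?B = {}"
  proof (intro equals0I)
    fix \<sigma> assume "\<sigma> \<in> ?A \<inter> ?B"
    then show False using first[of \<sigma>] by simp
  qed
  ultimately
  have split: "sum ?T (shuffle_perms m n) = sum ?T ?A + sum ?T ?B"
    by (metis (no_types, lifting) finite_Un finite_shuffle_perms sum.union_disjoint)
  have A: "sum ?T ?A = unshuffle_sum xs (\<lambda>as bs. if length (x # as) = m \<and> length bs = n then F (x # as) bs else 0)"
  proof (cases m)
    case (Suc k)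
    have "?A = lift_perm ` shuffle_perms k n" using shuffle_first_left[of k n] Suc by auto
    then have "sum ?T ?A = (\<Sum>\<sigma>\<in>shuffle_perms k n. ?T (lift_perm \<sigma>))"
      by (simp add: sum.reindex[OF inj_on_subset[OF inj_lift_perm subset_UNIV]])
    also have "\<dots> = (\<Sum>\<sigma>\<in>shuffle_perms k n. of_int (sign \<sigma>) *s
            F (x # map (\<lambda>i. xs ! \<sigma> i) [0..<k]) (map (\<lambda>i. xs ! \<sigma> i) [k..<k + n]))"
      by (rule sum.cong[OF refl])
        (auto simp: Suc map_upt_Suc_front map_upt_shift shuffle_perms_def simp del: upt_Suc dest: lift_perm_permutes_sign)
    also have "\<dots> = unshuffle_sum xs (\<lambda>as bs. if length as = k \<and> length bs = n then F (x # as) bs else 0)"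
      using len Suc by (intro Cons.IH) simp
    finally show ?thesis using Suc by simp
  qed simp
  have B: "sum ?T ?B = unshuffle_sum xs (\<lambda>as bs. sign_act (length as) (if length as = m \<and> length (x # bs) = n then F as (x # bs) else 0))"
  proof (cases n)
    case (Suc k)
    have "inj (\<lambda>\<tau>. lift_perm \<tau> \<circ> front_cycle m)"
    proof (rule injI)
      fix \<sigma> \<tau> assume "lift_perm \<sigma> \<circ> front_cycle m = lift_perm \<tau> \<circ> front_cycle m"
      moreover have "surj (front_cycle m)"
        using front_cycle_permutes_sign[of m "Suc m"] permutes_surj by blast
      ultimately have "lift_perm \<sigma> = lift_perm \<tau>" by (metis fun.map_comp o_id surj_iff)
      then show "\<sigma> = \<tau>" using inj_lift_perm by (simp add: inj_eq)
    qed
    moreover have "?B = (\<lambda>\<tau>. lift_perm \<tau> \<circ> front_cycle m) ` shuffle_perms m k"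
      using shuffle_first_right[of m k] Suc by auto
    ultimately have "sum ?T ?B = (\<Sum>\<sigma>\<in>shuffle_perms m k. ?T (lift_perm \<sigma> \<circ> front_cycle m))"
      by (simp add: sum.reindex[OF inj_on_subset[OF _ subset_UNIV]])
    also have "\<dots> = (\<Sum>\<sigma>\<in>shuffle_perms m k. of_int (sign \<sigma>) *s
            sign_act m (F (map (\<lambda>i. xs ! \<sigma> i) [0..<m]) (x # map (\<lambda>i. xs ! \<sigma> i) [m..<m + k])))"
    proof (rule sum.cong[OF refl])
      fix \<sigma> assume "\<sigma> \<in> shuffle_perms m k"
      then have s: "\<sigma> permutes {..<m + k}" by (simp add: shuffle_perms_def)
      have "front_cycle m permutes {..<Suc (m + k)}" "sign (front_cycle m) = (-1) ^ m"
        using front_cycle_permutes_sign[of m "Suc (m + k)"] by auto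
      moreover note lift_perm_permutes_sign[OF s]
      ultimately have "sign (lift_perm \<sigma> \<circ> front_cycle m) = sign \<sigma> * (-1) ^ m"
        by (metis finite_lessThan permutation_permutes sign_compose)
      moreover have "map (\<lambda>i. (x # xs) ! (lift_perm \<sigma> \<circ> front_cycle m) i) [0..<m] = map (\<lambda>i. xs ! \<sigma> i) [0..<m]"
        by (simp add: lift_perm_front_cycle del: comp_apply)
      moreover have "map (\<lambda>i. (x # xs) ! (lift_perm \<sigma> \<circ> front_cycle m) i) [m..<m + n] =
          x # map (\<lambda>i. xs ! \<sigma> i) [m..<m + k]"
        unfolding Suc add_Suc_right
        by (subst upt_conv_Cons) (simp_all add: lift_perm_front_cycle map_upt_shift del: comp_apply upt_Suc)
      ultimately show "?T (lift_perm \<sigma> \<circ> front_cycle m) = of_int (sign \<sigma>) *s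
            sign_act m (F (map (\<lambda>i. xs ! \<sigma> i) [0..<m]) (x # map (\<lambda>i. xs ! \<sigma> i) [m..<m + k]))"
        by (simp only: of_int_mult scale_scale[symmetric] scale_sign_sign_act)
    qed
    also have "\<dots> = unshuffle_sum xs (\<lambda>as bs. if length as = m \<and> length bs = k then sign_act m (F as (x # bs)) else 0)"
      using len Suc by (intro Cons.IH) simp
    also have "\<dots> = unshuffle_sum xs (\<lambda>as bs. sign_act (length as) (if length as = m \<and> length (x # bs) = n then F as (x # bs) else 0))"
      by (rule unshuffle_sum_cong) (simp add: Suc)
    finally show ?thesis .
  qed simp
  show ?case unfolding split A B by simp
qed

end

section \<open>Multilinear maps and cochains\<close>

context hom_lie_algebra
begin

abbreviation lin :: "('v \<Rightarrow> 'v) \<Rightarrow> bool" where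
  "lin \<equiv> Vector_Spaces.linear scale scale"

lemma lin_iff: "lin g \<longleftrightarrow> (\<forall>v w. g (v + w) = g v + g w) \<and> (\<forall>c v. g (c *s v) = c *s g v)"
  by (simp add: Vector_Spaces.linear_iff vector_space_axioms)

lemma lin_compose: "lin f \<Longrightarrow> lin g \<Longrightarrow> lin (\<lambda>v. f (g v))"
  by (simp add: lin_iff)

lemma lin_add: "lin f \<Longrightarrow> lin g \<Longrightarrow> lin (\<lambda>v. f v + g v)"
  by (simp add: lin_iff scale_right_distrib)

lemma lin_sign_act: "lin f \<Longrightarrow> lin (\<lambda>v. sign_act k (f v))"
  by (simp add: lin_iff sign_act_add scale_sign_act)

lemma scale_unshuffle_sum: "c *s unshuffle_sum xs F = unshuffle_sum xs (\<lambda>as bs. c *s F as bs)"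
  by (rule unshuffle_sum_additive) (rule scale_right_distrib)

lemma lin_unshuffle_sum: "(\<And>as bs. lin (\<lambda>v. F v as bs)) \<Longrightarrow> lin (\<lambda>v. unshuffle_sum xs (F v))"
  unfolding lin_iff scale_unshuffle_sum unshuffle_sum_add[symmetric] by (auto intro!: unshuffle_sum_cong)

text \<open>
  Multilinearity of a map on lists is linearity in the entry between any two lists \<open>pre\<close> and
  \<open>post\<close>. This form avoids indices and is stable under the recursion.
\<close>

lemma unshuffle_sum_multilinear:
  assumes "\<And>pre post bs. lin (\<lambda>v. F (pre @ v # post) bs)"
    and "\<And>as pre post. lin (\<lambda>v. F as (pre @ v # post))"
  shows "lin (\<lambda>v. unshuffle_sum (pre @ v # post) F)"
  using assms
proof (induction pre arbitrary: F)
  case Nil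
  have "lin (\<lambda>v. F (v # as) bs)" "lin (\<lambda>v. F as (v # bs))" for as bs
    using Nil(1)[of "[]"] Nil(2)[of _ "[]"] by simp_all
  then show ?case by (simp add: lin_add lin_unshuffle_sum lin_sign_act)
next
  case (Cons y pre)
  have "lin (\<lambda>v. unshuffle_sum (pre @ v # post) (\<lambda>as bs. F (y # as) bs))"
    using Cons.prems(1)[of "y # _"] Cons.prems(2) by (intro Cons.IH) simp_all
  moreover have "lin (\<lambda>v. unshuffle_sum (pre @ v # post) (\<lambda>as bs. sign_act (length as) (F as (y # bs))))"
    using Cons.prems(2)[of _ "y # _"] Cons.prems(1) by (intro Cons.IH) (simp_all add: lin_sign_act)
  ultimately show ?case by (simp add: lin_add)
qed

lemma lie_add_left: "lie (x + y) z = lie x z + lie y z"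
  using lie_linear_left[of z] by (simp add: lin_iff)

lemma lie_add_right: "lie x (y + z) = lie x y + lie x z"
  using lie_linear_right[of x] by (simp add: lin_iff)

lemma lie_zero [simp]: "lie 0 y = 0" "lie x 0 = 0"
  using lie_add_left[of 0 0 y] lie_add_right[of x 0 0] by simp_all

lemma lie_minus: "lie (- x) y = - lie x y" "lie x (- y) = - lie x y"
  using lie_add_left[of x "- x" y] lie_add_right[of x y "- y"]
  by (simp_all add: eq_neg_iff_add_eq_0 add.commute)

text \<open>
  Skew-symmetry gives \<open>[x, x] = 0\<close> because 2 is invertible in \<open>'k\<close>; this makes the Lie bracket an
  alternating, not only a skew-symmetric, cochain.
\<close>

lemma lie_self [simp]: "lie x x = 0"
proof -
  have "lie x x + lie x x = 0" using lie_skew[of x x] by (simp add: eq_neg_iff_add_eq_0)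
  then have "(2 :: 'k) *s lie x x = 0"
    using scale_left_distrib[of 1 1 "lie x x"] by simp
  then show ?thesis by simp
qed

lemma lin_alpha_power: "lin (\<alpha> ^^ k)"
proof (induction k)
  case 0
  show ?case by (simp add: lin_iff)
next
  case (Suc k)
  then show ?case using alpha_linear by (simp add: lin_iff)
qed

lemma alpha_power_add: "(\<alpha> ^^ k) (x + y) = (\<alpha> ^^ k) x + (\<alpha> ^^ k) y"
  using lin_alpha_power by (simp add: lin_iff)

lemma alpha_power_zero [simp]: "(\<alpha> ^^ k) 0 = 0"
  using alpha_power_add[of k 0 0] by simp

lemma alpha_power_lie: "(\<alpha> ^^ k) (lie x y) = lie ((\<alpha> ^^ k) x) ((\<alpha> ^^ k) y)"
  by (induction k) (simp_all add: alpha_lie)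

lemma alpha_power_power: "(\<alpha> ^^ j) ((\<alpha> ^^ k) x) = (\<alpha> ^^ (j + k)) x"
  by (simp add: funpow_add)

lemma alpha_power_alpha: "(\<alpha> ^^ k) (\<alpha> x) = \<alpha> ((\<alpha> ^^ k) x)"
  by (simp add: funpow_swap1)

text \<open>
  The form of the Hom-Jacobi identity that matches the graded Jacobi identity of the cup
  bracket entry by entry.
\<close>

lemma hom_leibniz: "lie (\<alpha> x) (lie y z) = lie (lie x y) (\<alpha> z) + lie (\<alpha> y) (lie x z)"
  using hom_jacobi[of x y z] lie_skew[of "\<alpha> z" "lie x y"] lie_skew[of z x]
  by (simp add: lie_minus algebra_simps)

definition multilinear :: "('v list \<Rightarrow> 'v) \<Rightarrow> bool" where
  "multilinear f \<longleftrightarrow> (\<forall>pre post. lin (\<lambda>x. f (pre @ x # post)))"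

lemma multilinearD: "multilinear f \<Longrightarrow> lin (\<lambda>x. f (pre @ x # post))"
  by (simp add: multilinear_def)

lemma multilinear_add: "multilinear f \<Longrightarrow> f (pre @ (x + y) # post) = f (pre @ x # post) + f (pre @ y # post)"
  by (simp add: multilinear_def lin_iff)

lemma multilinear_hd_add: "multilinear f \<Longrightarrow> f ((x + y) # post) = f (x # post) + f (y # post)"
  using multilinear_add[of f "[]"] by simp

lemma multilinear_zero: "multilinear f \<Longrightarrow> f (pre @ 0 # post) = 0"
  using multilinear_add[of f pre 0 0 post] by simp

lemma multilinear_hd_zero: "multilinear f \<Longrightarrow> f (0 # post) = 0"
  using multilinear_zero[of f "[]"] by simp

lemma adjacent_alternating_swap:
  assumes "multilinear f" "\<And>pre x post. f (pre @ x # x # post) = 0"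
  shows "f (pre @ y # x # post) = - f (pre @ x # y # post)"
proof -
  have "f (pre @ (x + y) # (x + y) # post) = f (pre @ x # x # post) + f (pre @ x # y # post) +
      f (pre @ y # x # post) + f (pre @ y # y # post)"
    using multilinear_add[OF assms(1), of "pre @ [_]"] by (simp add: multilinear_add[OF assms(1)])
  then show ?thesis using assms(2) by (simp add: eq_neg_iff_add_eq_0 add.commute)
qed

text \<open>
  Adjacent transpositions change the sign, so the first of two equal entries can be moved next
  to the second one.
\<close>

lemma adjacent_alternating_imp_alternating:
  assumes "multilinear f" "\<And>pre x post. f (pre @ x # x # post) = 0"
  shows "f (pre @ x # mid @ x # post) = 0"
proof (induction mid arbitrary: pre)
  case (Cons y mid)
  show ?case
    using Cons.IH[of "pre @ [y]"] adjacent_alternating_swap[OF assms, of pre x y "mid @ x # post"] by simp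
qed (simp add: assms(2))

lemma cochainsI:
  assumes "\<And>xs. length xs \<noteq> n \<Longrightarrow> f xs = 0" "multilinear f"
    "\<And>pre x post. f (pre @ x # x # post) = 0" "\<And>xs. \<alpha> (f xs) = f (map \<alpha> xs)"
  shows "f \<in> cochains n"
proof -
  have "lin (\<lambda>x. f (xs[i := x]))" if "i < length xs" for xs i
    using multilinearD[OF assms(2), of "take i xs"] that by (simp add: upd_conv_take_nth_drop)
  moreover have "f xs = 0" if "length xs = n \<and> i < j \<and> j < n \<and> xs ! i = xs ! j" for xs i j
  proof -
    define ys where "ys = drop (Suc i) xs"
    have y: "j - Suc i < length ys" "ys ! (j - Suc i) = xs ! i" using that by (auto simp: ys_def)
    have "f xs = f (take i xs @ xs ! i # ys)"
      unfolding ys_def by (rule arg_cong[where f = f], rule id_take_nth_drop) (use that in simp)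
    also have "\<dots> = f (take i xs @ xs ! i # (take (j - Suc i) ys @ xs ! i # drop (Suc (j - Suc i)) ys))"
      using id_take_nth_drop[OF y(1)] unfolding y(2) by (rule arg_cong)
    also have "\<dots> = 0" by (rule adjacent_alternating_imp_alternating[OF assms(2,3)])
    finally show ?thesis .
  qed
  ultimately show ?thesis
    unfolding cochains_def using assms(1,4) by (intro CollectI conjI allI impI) metis+
qed

lemma cochains_length: "f \<in> cochains n \<Longrightarrow> length xs \<noteq> n \<Longrightarrow> f xs = 0"
  by (simp add: cochains_def)

lemma cochains_multilinear:
  assumes "f \<in> cochains n"
  shows "multilinear f"
  unfolding multilinear_def
proof (intro allI)
  fix pre post :: "'v list"
  show "lin (\<lambda>x. f (pre @ x # post))"
  proof (cases "length pre + length post + 1 = n")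
    case True
    have "lin (\<lambda>x. f (xs[i := x]))" if "length xs = n \<and> i < n" for xs i
      using assms that unfolding cochains_def by blast
    from this[of "pre @ 0 # post" "length pre"] True have "lin (\<lambda>x. f ((pre @ 0 # post)[length pre := x]))"
      by simp
    then show ?thesis by simp
  next
    case False
    then show ?thesis using cochains_length[OF assms] by (simp add: lin_iff)
  qed
qed

lemma cochains_adjacent: "f \<in> cochains n \<Longrightarrow> f (pre @ x # x # post) = 0"
proof (cases "length (pre @ x # x # post) = n")
  case True
  assume "f \<in> cochains n"
  then have "f xs = 0" if "length xs = n" "i < j" "j < n" "xs ! i = xs ! j" for xs i j
    using that unfolding cochains_def by blast
  from this[OF True, of "length pre" "Suc (length pre)"] show ?thesis using True by (simp add: nth_append)
qed (rule cochains_length)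

lemma cochains_swap: "f \<in> cochains n \<Longrightarrow> f (y # x # post) = - f (x # y # post)"
  using adjacent_alternating_swap[of f "[]" y x post] cochains_multilinear cochains_adjacent[of f n] by simp

lemma cochains_alpha: "f \<in> cochains n \<Longrightarrow> \<alpha> (f xs) = f (map \<alpha> xs)"
proof (cases "length xs = n")
  case False
  assume "f \<in> cochains n"
  then have "f xs = 0" "f (map \<alpha> xs) = 0" using False cochains_length[of f n] by simp_all
  then show ?thesis using alpha_power_zero[of 1] by simp
qed (simp add: cochains_def)

lemma cochains_alpha_power: "f \<in> cochains n \<Longrightarrow> (\<alpha> ^^ k) (f xs) = f (map (\<alpha> ^^ k) xs)"
proof (induction k)
  case (Suc k)
  then show ?case using cochains_alpha[of f n "map (\<alpha> ^^ k) xs"] by (simp add: o_def)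
qed simp

lemma map_alpha_alpha_power: "map (\<alpha> ^^ k) (map \<alpha> xs) = map \<alpha> (map (\<alpha> ^^ k) xs)"
  by (simp add: alpha_power_alpha)

section \<open>Insertion and cup bracket\<close>

text \<open>
  The insertion \<open>i\<^sub>P Q\<close> and the cup bracket \<open>[P, Q]\<^sub>C\<close>. The numbers \<open>a\<close> and \<open>b\<close> are the arities of \<open>P\<close>
  and \<open>Q\<close> minus one. These are the exponents of \<open>\<alpha>\<close> and the degrees for the Nijenhuis-Richardson
  bracket, and they are additive under insertion.
\<close>

definition iota :: "nat \<Rightarrow> ('v list \<Rightarrow> 'v) \<Rightarrow> ('v list \<Rightarrow> 'v) \<Rightarrow> 'v list \<Rightarrow> 'v" where
  "iota a P Q = (\<lambda>xs. unshuffle_sum xs (\<lambda>as bs. Q (P as # map (\<alpha> ^^ a) bs)))"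

definition cup :: "nat \<Rightarrow> nat \<Rightarrow> ('v list \<Rightarrow> 'v) \<Rightarrow> ('v list \<Rightarrow> 'v) \<Rightarrow> 'v list \<Rightarrow> 'v" where
  "cup a b P Q = (\<lambda>xs. unshuffle_sum xs (\<lambda>as bs. lie ((\<alpha> ^^ b) (P as)) ((\<alpha> ^^ a) (Q bs))))"

text \<open>
  The Lie bracket as a binary cochain, called \<open>\<mu>\<close> in the explanations.
\<close>

definition lie_cochain :: "'v list \<Rightarrow> 'v" where
  "lie_cochain xs = (case xs of [x, y] \<Rightarrow> lie x y | _ \<Rightarrow> 0)"

lemma lie_cochain_simps [simp]: "lie_cochain [x, y] = lie x y" "lie_cochain [] = 0" "lie_cochain [x] = 0"
  "lie_cochain (x # y # z # zs) = 0"
  by (simp_all add: lie_cochain_def)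

lemma lie_cochain_length: "length xs \<noteq> 2 \<Longrightarrow> lie_cochain xs = 0"
  by (auto simp: lie_cochain_def split: list.splits)

lemma lie_cochain_cochain: "lie_cochain \<in> cochains 2"
proof (rule cochainsI)
  show "multilinear lie_cochain"
    unfolding multilinear_def
  proof (intro allI)
    fix pre post :: "'v list"
    consider y where "pre = []" "post = [y]" | y where "pre = [y]" "post = []"
      | "length pre + length post \<noteq> 1"
      by (cases pre; cases post) (auto simp: length_Suc_conv)
    then show "lin (\<lambda>x. lie_cochain (pre @ x # post))"
    proof cases
      case 3
      then show ?thesis by (simp add: lie_cochain_length lin_iff)
    qed (simp_all add: lie_linear_left lie_linear_right)
  qed
  show "lie_cochain (pre @ x # x # post) = 0" for pre x post
    by (cases pre; cases post) (simp_all add: lie_cochain_length)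
  show "\<alpha> (lie_cochain xs) = lie_cochain (map \<alpha> xs)" for xs
    using alpha_power_zero[of 1] by (auto simp: lie_cochain_def alpha_lie split: list.splits)
qed (rule lie_cochain_length)

lemma alpha_unshuffle_sum: "\<alpha> (unshuffle_sum xs F) = unshuffle_sum xs (\<lambda>as bs. \<alpha> (F as bs))"
  using alpha_power_add[of 1] by (intro unshuffle_sum_additive) simp

lemma alpha_power_unshuffle_sum: "(\<alpha> ^^ k) (unshuffle_sum xs F) = unshuffle_sum xs (\<lambda>as bs. (\<alpha> ^^ k) (F as bs))"
  by (intro unshuffle_sum_additive alpha_power_add)

lemma lie_unshuffle_sum_left: "lie (unshuffle_sum xs F) y = unshuffle_sum xs (\<lambda>as bs. lie (F as bs) y)"
  by (intro unshuffle_sum_additive[of "\<lambda>x. lie x y"] lie_add_left)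

lemma lie_unshuffle_sum_right: "lie x (unshuffle_sum xs F) = unshuffle_sum xs (\<lambda>as bs. lie x (F as bs))"
  by (intro unshuffle_sum_additive[of "\<lambda>y. lie x y"] lie_add_right)

lemma multilinear_hd_unshuffle_sum: "multilinear f \<Longrightarrow> f (unshuffle_sum xs F # ys) = unshuffle_sum xs (\<lambda>as bs. f (F as bs # ys))"
  by (intro unshuffle_sum_additive[of "\<lambda>y. f (y # ys)"] multilinear_hd_add)

lemma iota_eq_0:
  assumes "P \<in> cochains (Suc a)" "Q \<in> cochains (Suc b)" "length as + length bs \<noteq> Suc (a + b)"
  shows "Q (P as # map (\<alpha> ^^ k) bs) = 0"
proof (cases "length as = Suc a")
  case True
  then show ?thesis using assms by (intro cochains_length[OF assms(2)]) auto
next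
  case False
  then show ?thesis
    using cochains_length[OF assms(1)] multilinear_hd_zero[OF cochains_multilinear[OF assms(2)]] by simp
qed

lemma iota_cochain:
  assumes P: "P \<in> cochains (Suc a)" and Q: "Q \<in> cochains (Suc b)"
  shows "iota a P Q \<in> cochains (Suc (a + b))"
proof (rule cochainsI)
  note mP = cochains_multilinear[OF P] and mQ = cochains_multilinear[OF Q]
  let ?F = "\<lambda>as bs. Q (P as # map (\<alpha> ^^ a) bs)"
  show "iota a P Q xs = 0" if "length xs \<noteq> Suc (a + b)" for xs
    unfolding iota_def using that by (intro unshuffle_sum_eq_0 iota_eq_0[OF P Q]) simp
  show "multilinear (iota a P Q)"
    unfolding multilinear_def iota_def
  proof (intro allI unshuffle_sum_multilinear)
    fix pre post as bs :: "'v list"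
    show "lin (\<lambda>v. ?F (pre @ v # post) bs)"
      using lin_compose[OF multilinearD[OF mQ, of "[]"] multilinearD[OF mP]] by simp
    show "lin (\<lambda>v. ?F as (pre @ v # post))"
      using lin_compose[OF multilinearD[OF mQ, of "P as # map (\<alpha> ^^ a) pre" "map (\<alpha> ^^ a) post"] lin_alpha_power[of a]]
      by simp
  qed
  show "iota a P Q (pre @ x # x # post) = 0" for pre x post
    unfolding iota_def
  proof (rule unshuffle_sum_alternating)
    fix pre post as bs :: "'v list" and x
    show "?F (pre @ x # x # post) bs = 0"
      by (simp add: cochains_adjacent[OF P] multilinear_hd_zero[OF mQ])
    show "?F as (pre @ x # x # post) = 0"
      using cochains_adjacent[OF Q, of "P as # map (\<alpha> ^^ a) pre"] by simp
  qed
  show "\<alpha> (iota a P Q xs) = iota a P Q (map \<alpha> xs)" for xs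
    unfolding iota_def alpha_unshuffle_sum unshuffle_sum_map map_alpha_alpha_power
    by (simp add: cochains_alpha[OF P] cochains_alpha[OF Q] del: map_map)
qed

lemma cup_cochain:
  assumes P: "P \<in> cochains (Suc a)" and Q: "Q \<in> cochains (Suc b)"
  shows "cup a b P Q \<in> cochains (Suc (Suc (a + b)))"
proof (rule cochainsI)
  note mP = cochains_multilinear[OF P] and mQ = cochains_multilinear[OF Q]
  let ?F = "\<lambda>as bs. lie ((\<alpha> ^^ b) (P as)) ((\<alpha> ^^ a) (Q bs))"
  show "cup a b P Q xs = 0" if "length xs \<noteq> Suc (Suc (a + b))" for xs
    unfolding cup_def
  proof (rule unshuffle_sum_eq_0)
    fix as bs :: "'v list" assume "length as + length bs = length xs"
    then have "length as \<noteq> Suc a \<or> length bs \<noteq> Suc b" using that by auto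
    then show "?F as bs = 0" using cochains_length[OF P] cochains_length[OF Q] by auto
  qed
  show "multilinear (cup a b P Q)"
    unfolding multilinear_def cup_def
  proof (intro allI unshuffle_sum_multilinear)
    fix pre post as bs :: "'v list"
    show "lin (\<lambda>v. ?F (pre @ v # post) bs)"
      using lin_compose[OF lie_linear_left lin_compose[OF lin_alpha_power[of b] multilinearD[OF mP]]] by simp
    show "lin (\<lambda>v. ?F as (pre @ v # post))"
      using lin_compose[OF lie_linear_right lin_compose[OF lin_alpha_power[of a] multilinearD[OF mQ]]] by simp
  qed
  show "cup a b P Q (pre @ x # x # post) = 0" for pre x post
    unfolding cup_def
    by (rule unshuffle_sum_alternating) (simp_all add: cochains_adjacent[OF P] cochains_adjacent[OF Q])
  show "\<alpha> (cup a b P Q xs) = cup a b P Q (map \<alpha> xs)" for xs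
    unfolding cup_def alpha_unshuffle_sum unshuffle_sum_map
    by (simp add: alpha_lie alpha_power_alpha[symmetric] cochains_alpha[OF P] cochains_alpha[OF Q])
qed

lemma cochains_add: "f \<in> cochains n \<Longrightarrow> g \<in> cochains n \<Longrightarrow> f + g \<in> cochains n"
  using alpha_linear
  by (auto simp: cochains_def lin_iff scale_right_distrib algebra_simps)

lemma cochains_cscale: "f \<in> cochains n \<Longrightarrow> cscale c f \<in> cochains n"
  using alpha_linear
  by (auto simp: cochains_def cscale_def lin_iff scale_right_distrib scale_left_commute mult.commute)

lemma cochains_zero: "0 \<in> cochains n"
  using alpha_power_zero[of 1] by (auto simp: cochains_def lin_iff)

lemma cscale_sign: "cscale ((- 1) ^ k) f = sign_act k f"
  by (auto simp: cscale_def sign_act_def fun_eq_iff)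

lemma cochains_sign_act: "f \<in> cochains n \<Longrightarrow> sign_act k f \<in> cochains n"
  using cochains_cscale[of f n "(- 1) ^ k"] by (simp add: cscale_sign)

lemma cochains_minus: "f \<in> cochains n \<Longrightarrow> g \<in> cochains n \<Longrightarrow> f - g \<in> cochains n"
  using cochains_add[of f n "sign_act 1 g"] cochains_sign_act[of g n 1] by (simp add: sign_act_def)

section \<open>The pre-Lie identity and the cup bracket\<close>

text \<open>
  In \<open>i\<^sub>P (i\<^sub>Q R)\<close> the value of \<open>P\<close> is the first of the arguments that are distributed between \<open>Q\<close>
  and \<open>R\<close>. If it goes to \<open>Q\<close>, coassociativity gives \<open>i\<^bsub>i\<^sub>P Q\<^esub> R\<close>. If it goes to \<open>R\<close>, it passes
  the \<open>Suc b\<close> arguments of \<open>Q\<close>, and \<open>P\<close> and \<open>Q\<close> occupy two different arguments of \<open>R\<close>.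
\<close>

lemma iota_iota:
  assumes P: "P \<in> cochains (Suc a)" and Q: "Q \<in> cochains (Suc b)" and R: "R \<in> cochains (Suc c)"
  shows "iota a P (iota b Q R) xs = iota (a + b) (iota a P Q) R xs +
    unshuffle_sum xs (\<lambda>as us. unshuffle_sum us (\<lambda>bs cs.
      sign_act (Suc b) (R ((\<alpha> ^^ a) (Q bs) # (\<alpha> ^^ b) (P as) # map (\<alpha> ^^ (a + b)) cs))))"
proof -
  have 1: "R (Q (map (\<alpha> ^^ a) bs) # map (\<alpha> ^^ b) (P as # map (\<alpha> ^^ a) cs)) =
      R ((\<alpha> ^^ a) (Q bs) # (\<alpha> ^^ b) (P as) # map (\<alpha> ^^ (a + b)) cs)" for as bs cs
    by (simp add: cochains_alpha_power[OF Q] o_def alpha_power_power add.commute)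
  \<comment> \<open>The sign of passing \<open>bs\<close> is constant, because \<open>Q\<close> vanishes on other lengths.\<close>
  have 2: "sign_act (length bs) (R ((\<alpha> ^^ a) (Q bs) # ys)) = sign_act (Suc b) (R ((\<alpha> ^^ a) (Q bs) # ys))" for bs ys
    using cochains_length[OF Q, of bs] multilinear_hd_zero[OF cochains_multilinear[OF R]]
    by (cases "length bs = Suc b") simp_all
  have "iota a P (iota b Q R) xs =
    unshuffle_sum xs (\<lambda>as us. unshuffle_sum us (\<lambda>bs cs. R (Q (P as # map (\<alpha> ^^ a) bs) # map (\<alpha> ^^ (a + b)) cs))) +
    unshuffle_sum xs (\<lambda>as us. unshuffle_sum us (\<lambda>bs cs.
      sign_act (Suc b) (R ((\<alpha> ^^ a) (Q bs) # (\<alpha> ^^ b) (P as) # map (\<alpha> ^^ (a + b)) cs))))"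
    unfolding iota_def unshuffle_sum.simps unshuffle_sum_map length_map 1 2 unshuffle_sum_add
    by (simp add: o_def alpha_power_power add.commute)
  also have "unshuffle_sum xs (\<lambda>as us. unshuffle_sum us (\<lambda>bs cs. R (Q (P as # map (\<alpha> ^^ a) bs) # map (\<alpha> ^^ (a + b)) cs))) =
    iota (a + b) (iota a P Q) R xs"
    unfolding unshuffle_sum_coassoc iota_def multilinear_hd_unshuffle_sum[OF cochains_multilinear[OF R]] by (rule refl)
  finally show ?thesis .
qed

text \<open>
  The graded pre-Lie identity. Exchanging \<open>P\<close> and \<open>Q\<close> in the remaining sum of \<open>iota_iota\<close> swaps two
  blocks of \<open>Suc a\<close> and \<open>Suc b\<close> entries and two arguments of \<open>R\<close>, and replaces the sign
  \<open>(-1)\<^bsup>Suc b\<^esup>\<close> by \<open>(-1)\<^bsup>Suc a\<^esup>\<close>; together these are \<open>(-1)\<^bsup>a b\<^esup>\<close>.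
\<close>

lemma iota_commutator:
  assumes P: "P \<in> cochains (Suc a)" and Q: "Q \<in> cochains (Suc b)" and R: "R \<in> cochains (Suc c)"
  shows "iota a P (iota b Q R) - iota (a + b) (iota a P Q) R =
    sign_act (a * b) (iota b Q (iota a P R) - iota (a + b) (iota b Q P) R)" (is "?L = sign_act _ ?R")
proof
  fix xs
  have "sign_act (length as * length bs) (sign_act (Suc b) (R ((\<alpha> ^^ a) (Q bs) # (\<alpha> ^^ b) (P as) # ys))) =
      sign_act (a * b) (sign_act (Suc a) (R ((\<alpha> ^^ b) (P as) # (\<alpha> ^^ a) (Q bs) # ys)))" for as bs ys
  proof (cases "length as = Suc a \<and> length bs = Suc b")
    case True
    then show ?thesis
      unfolding cochains_swap[OF R, of "(\<alpha> ^^ a) (Q bs)"] by (auto simp: sign_act_def)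
  next
    case False
    moreover have "R (x # 0 # ys) = 0" "R (0 # x # ys) = 0" for x
      using multilinear_zero[OF cochains_multilinear[OF R], of "[_]"]
        multilinear_hd_zero[OF cochains_multilinear[OF R]] by simp_all
    ultimately show ?thesis
      using cochains_length[OF P, of as] cochains_length[OF Q, of bs] by auto
  qed
  note * = this
  have "?L xs = unshuffle_sum xs (\<lambda>as us. unshuffle_sum us (\<lambda>bs cs.
      sign_act (Suc b) (R ((\<alpha> ^^ a) (Q bs) # (\<alpha> ^^ b) (P as) # map (\<alpha> ^^ (a + b)) cs))))"
    by (simp add: iota_iota[OF P Q R])
  also have "\<dots> = sign_act (a * b) (unshuffle_sum xs (\<lambda>bs us. unshuffle_sum us (\<lambda>as cs.
      sign_act (Suc a) (R ((\<alpha> ^^ b) (P as) # (\<alpha> ^^ a) (Q bs) # map (\<alpha> ^^ (a + b)) cs)))))"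
    by (subst unshuffle_sum_swap) (simp only: * unshuffle_sum_sign_act)
  also have "\<dots> = sign_act (a * b) (?R xs)"
    using iota_iota[OF Q P R] by (simp add: add.commute)
  finally show "?L xs = sign_act (a * b) ?R xs" by (simp add: sign_act_apply)
qed

text \<open>
  For \<open>R = \<mu>\<close> the remaining sum of \<open>iota_iota\<close> has no further arguments, because \<open>\<mu>\<close> is binary, and
  so it is a cup bracket.
\<close>

lemma iota_iota_lie:
  assumes P: "P \<in> cochains (Suc a)" and Q: "Q \<in> cochains (Suc b)"
  shows "iota a P (iota b Q lie_cochain) = iota (a + b) (iota a P Q) lie_cochain + sign_act b (cup a b P Q)"
proof
  fix xs
  have L: "lie_cochain \<in> cochains (Suc 1)" using lie_cochain_cochain by (simp add: numeral_2_eq_2)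
  have *: "unshuffle_sum us (\<lambda>bs cs. sign_act (Suc b) (lie_cochain ((\<alpha> ^^ a) (Q bs) # (\<alpha> ^^ b) (P as) # map f cs))) =
     sign_act b (lie ((\<alpha> ^^ b) (P as)) ((\<alpha> ^^ a) (Q us)))" for as us and f :: "'v \<Rightarrow> 'v"
  proof (induction us arbitrary: Q)
    case Nil
    then show ?case using lie_skew[of "(\<alpha> ^^ a) (Q [])" "(\<alpha> ^^ b) (P as)"] by (simp add: sign_act_def)
  next
    case (Cons u us)
    have "unshuffle_sum us (\<lambda>bs cs. sign_act (length bs) (sign_act (Suc b)
        (lie_cochain ((\<alpha> ^^ a) (Q bs) # (\<alpha> ^^ b) (P as) # map f (u # cs))))) = 0"
      by (intro unshuffle_sum_eq_0) simp
    then show ?case using Cons.IH[of "\<lambda>bs. Q (u # bs)"] by simp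
  qed
  show "iota a P (iota b Q lie_cochain) xs = (iota (a + b) (iota a P Q) lie_cochain + sign_act b (cup a b P Q)) xs"
    unfolding iota_iota[OF P Q L] * by (simp add: cup_def sign_act_apply unshuffle_sum_sign_act)
qed

text \<open>
  Insertion is a graded derivation of the cup bracket of degree \<open>r\<close>, since the value of \<open>R\<close> becomes
  an argument of either \<open>P\<close> or \<open>Q\<close>. The powers of \<open>\<alpha>\<close> that hit the other factor commute with it
  and match the arity of the first.
\<close>

lemma iota_cup:
  assumes R: "R \<in> cochains (Suc r)" and P: "P \<in> cochains (Suc a)" and Q: "Q \<in> cochains (Suc b)"
  shows "iota r R (cup a b P Q) =
    cup (a + r) b (iota r R P) Q + sign_act (r * Suc a) (cup a (b + r) P (iota r R Q))"
proof
  fix xs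
  have 1: "(\<alpha> ^^ a) (Q (map (\<alpha> ^^ r) cs)) = (\<alpha> ^^ (a + r)) (Q cs)"
    "(\<alpha> ^^ b) (P (map (\<alpha> ^^ r) cs)) = (\<alpha> ^^ (b + r)) (P cs)" for cs
    unfolding cochains_alpha_power[OF Q, symmetric] cochains_alpha_power[OF P, symmetric] alpha_power_power
    by (rule refl)+
  have 2: "sign_act (length as * length bs) (sign_act (length bs) (lie ((\<alpha> ^^ k) (P bs)) ((\<alpha> ^^ a) (Q (R as # ys))))) =
      sign_act (r * Suc a) (lie ((\<alpha> ^^ k) (P bs)) ((\<alpha> ^^ a) (Q (R as # ys))))" for as bs ys k
  proof (cases "length as = Suc r \<and> length bs = Suc a")
    case True
    then show ?thesis by (auto simp: sign_act_def)
  next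
    case False
    then show ?thesis
      using cochains_length[OF P, of bs] cochains_length[OF R, of as]
        multilinear_hd_zero[OF cochains_multilinear[OF Q]] by auto
  qed
  have "iota r R (cup a b P Q) xs =
    unshuffle_sum xs (\<lambda>as us. unshuffle_sum us (\<lambda>bs cs. lie ((\<alpha> ^^ b) (P (R as # map (\<alpha> ^^ r) bs))) ((\<alpha> ^^ (a + r)) (Q cs)))) +
    unshuffle_sum xs (\<lambda>as us. unshuffle_sum us (\<lambda>bs cs. sign_act (length bs)
      (lie ((\<alpha> ^^ (b + r)) (P bs)) ((\<alpha> ^^ a) (Q (R as # map (\<alpha> ^^ r) cs))))))"
    unfolding iota_def cup_def unshuffle_sum.simps unshuffle_sum_map 1 length_map unshuffle_sum_add by (rule refl)
  also have "unshuffle_sum xs (\<lambda>as us. unshuffle_sum us (\<lambda>bs cs. lie ((\<alpha> ^^ b) (P (R as # map (\<alpha> ^^ r) bs))) ((\<alpha> ^^ (a + r)) (Q cs)))) =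
    cup (a + r) b (iota r R P) Q xs"
    unfolding unshuffle_sum_coassoc iota_def cup_def by (simp add: alpha_power_unshuffle_sum lie_unshuffle_sum_left)
  also have "unshuffle_sum xs (\<lambda>as us. unshuffle_sum us (\<lambda>bs cs. sign_act (length bs)
      (lie ((\<alpha> ^^ (b + r)) (P bs)) ((\<alpha> ^^ a) (Q (R as # map (\<alpha> ^^ r) cs)))))) =
    sign_act (r * Suc a) (cup a (b + r) P (iota r R Q) xs)"
    by (subst unshuffle_sum_swap) (simp only: 2 unshuffle_sum_sign_act iota_def cup_def alpha_power_unshuffle_sum lie_unshuffle_sum_right)
  finally show "iota r R (cup a b P Q) xs =
    (cup (a + r) b (iota r R P) Q + sign_act (r * Suc a) (cup a (b + r) P (iota r R Q))) xs"
    by (simp add: sign_act_apply)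
qed

lemma cup_skew:
  assumes P: "P \<in> cochains (Suc a)" and Q: "Q \<in> cochains (Suc b)"
  shows "cup a b P Q = - sign_act (Suc a * Suc b) (cup b a Q P)"
proof
  fix xs
  have "sign_act (length bs * length as) (lie ((\<alpha> ^^ b) (P bs)) ((\<alpha> ^^ a) (Q as))) =
     - sign_act (Suc a * Suc b) (lie ((\<alpha> ^^ a) (Q as)) ((\<alpha> ^^ b) (P bs)))" for as bs
  proof (cases "length bs = Suc a \<and> length as = Suc b")
    case True
    then show ?thesis
      using lie_skew[of "(\<alpha> ^^ b) (P bs)" "(\<alpha> ^^ a) (Q as)"] by (auto simp: sign_act_def)
  next
    case False
    then show ?thesis using cochains_length[OF P, of bs] cochains_length[OF Q, of as] by auto
  qed
  then show "cup a b P Q xs = (- sign_act (Suc a * Suc b) (cup b a Q P)) xs"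
    unfolding cup_def by (subst unshuffle_sum_cocomm) (simp only: unshuffle_sum_minus unshuffle_sum_sign_act sign_act_apply uminus_apply)
qed

text \<open>
  After moving all powers of \<open>\<alpha>\<close> inside, the summands of the three double brackets are
  \<open>[\<alpha> X, [Y, Z]]\<close>, \<open>[[X, Y], \<alpha> Z]\<close> and \<open>[\<alpha> Y, [X, Z]]\<close> with the same \<open>X\<close>, \<open>Y\<close> and \<open>Z\<close>, so
  that the Hom-Jacobi identity applies termwise.
\<close>

lemma cup_jacobi:
  assumes P: "P \<in> cochains (Suc a)" and Q: "Q \<in> cochains (Suc b)" and R: "R \<in> cochains (Suc c)"
  shows "cup a (Suc (b + c)) P (cup b c Q R) =
    cup (Suc (a + b)) c (cup a b P Q) R + sign_act (Suc a * Suc b) (cup b (Suc (a + c)) Q (cup a c P R))"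
proof
  fix xs
  define X where "X = (\<lambda>as. (\<alpha> ^^ (b + c)) (P as))"
  define Y where "Y = (\<lambda>as. (\<alpha> ^^ (a + c)) (Q as))"
  define Z where "Z = (\<lambda>as. (\<alpha> ^^ (a + b)) (R as))"
  have 1: "cup a (Suc (b + c)) P (cup b c Q R) xs =
      unshuffle_sum xs (\<lambda>as us. unshuffle_sum us (\<lambda>bs cs. lie (\<alpha> (X as)) (lie (Y bs) (Z cs))))"
    unfolding cup_def alpha_power_unshuffle_sum alpha_power_lie lie_unshuffle_sum_right X_def Y_def Z_def
    by (simp add: alpha_power_power add.commute)
  have 2: "cup b (Suc (a + c)) Q (cup a c P R) xs =
      unshuffle_sum xs (\<lambda>bs us. unshuffle_sum us (\<lambda>as cs. lie (\<alpha> (Y bs)) (lie (X as) (Z cs))))"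
    unfolding cup_def alpha_power_unshuffle_sum alpha_power_lie lie_unshuffle_sum_right X_def Y_def Z_def
    by (simp add: alpha_power_power add.commute)
  have 3: "cup (Suc (a + b)) c (cup a b P Q) R xs =
      unshuffle_sum xs (\<lambda>us cs. unshuffle_sum us (\<lambda>as bs. lie (lie (X as) (Y bs)) (\<alpha> (Z cs))))"
    unfolding cup_def alpha_power_unshuffle_sum alpha_power_lie lie_unshuffle_sum_left X_def Y_def Z_def
    by (simp add: alpha_power_power add.commute)
  have 4: "sign_act (length as * length bs) (lie (\<alpha> (Y bs)) (lie (X as) (Z cs))) =
      sign_act (Suc a * Suc b) (lie (\<alpha> (Y bs)) (lie (X as) (Z cs)))" for as bs cs
    using cochains_length[OF P, of as] cochains_length[OF Q, of bs] alpha_power_zero[of 1]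
    by (cases "length as = Suc a \<and> length bs = Suc b") (auto simp: X_def Y_def)
  have 5: "lie (\<alpha> (X as)) (lie (Y bs) (Z cs)) =
      lie (lie (X as) (Y bs)) (\<alpha> (Z cs)) + lie (\<alpha> (Y bs)) (lie (X as) (Z cs))" for as bs cs
    by (rule hom_leibniz)
  show "cup a (Suc (b + c)) P (cup b c Q R) xs =
    (cup (Suc (a + b)) c (cup a b P Q) R + sign_act (Suc a * Suc b) (cup b (Suc (a + c)) Q (cup a c P R))) xs"
    unfolding plus_fun_apply sign_act_apply 1 2 3 5 unshuffle_sum_add unshuffle_sum_coassoc[symmetric]
    by (subst (2) unshuffle_sum_swap) (simp only: 4 unshuffle_sum_sign_act)
qed

end

section \<open>The Nijenhuis-Richardson bracket and the differential\<close>

lemma sign_act_minus: "sign_act k (- v) = - sign_act k v"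
  by (simp add: sign_act_def)

lemma sign_act_diff: "sign_act k (v - w) = sign_act k v - sign_act k w"
  by (simp add: sign_act_def)

context hom_lie_algebra
begin

lemma iota_add_right: "iota a P (Q + R) = iota a P Q + iota a P R"
  by (auto simp: iota_def unshuffle_sum_add)

lemma iota_sign_act_right: "iota a P (sign_act k Q) = sign_act k (iota a P Q)"
  by (auto simp: iota_def sign_act_apply unshuffle_sum_sign_act)

lemma iota_diff_right: "iota a P (Q - R) = iota a P Q - iota a P R"
  using iota_add_right[of a P "Q - R" R] by (simp add: eq_diff_eq)

lemma iota_add_left: "multilinear R \<Longrightarrow> iota a (P + Q) R = iota a P R + iota a Q R"
  by (auto simp: iota_def unshuffle_sum_add multilinear_hd_add)

lemma iota_diff_left: "multilinear R \<Longrightarrow> iota a (P - Q) R = iota a P R - iota a Q R"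
  using iota_add_left[of R a "P - Q" Q] by (simp add: eq_diff_eq)

lemma iota_zero [simp]: "iota a P 0 = 0" "multilinear R \<Longrightarrow> iota a 0 R = 0"
  using iota_diff_right[of a P 0 0] iota_diff_left[of R a 0 0] by simp_all

lemma iota_sign_act_left: "multilinear R \<Longrightarrow> iota a (sign_act k P) R = sign_act k (iota a P R)"
  using iota_diff_left[of R a 0 P] by (simp add: sign_act_def)

lemma cup_add_right: "cup a b P (Q + R) = cup a b P Q + cup a b P R"
  by (auto simp: cup_def unshuffle_sum_add alpha_power_add lie_add_right)

lemma cup_add_left: "cup a b (P + Q) R = cup a b P R + cup a b Q R"
  by (auto simp: cup_def unshuffle_sum_add alpha_power_add lie_add_left)

lemma cup_diff_right: "cup a b P (Q - R) = cup a b P Q - cup a b P R"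
  using cup_add_right[of a b P "Q - R" R] by (simp add: eq_diff_eq)

lemma cup_zero_right [simp]: "cup a b P 0 = 0"
  using cup_diff_right[of a b P 0 0] by simp

lemma cup_sign_act_right: "cup a b P (sign_act k Q) = sign_act k (cup a b P Q)"
  using cup_diff_right[of a b P 0 Q] by (simp add: sign_act_def)

lemma double_eq_0:
  fixes X :: "'v list \<Rightarrow> 'v"
  assumes "X + X = 0"
  shows "X = 0"
proof
  fix xs
  have "(2 :: 'k) *s X xs = 0"
    using scale_left_distrib[of 1 1 "X xs"] fun_cong[OF assms, of xs] by simp
  then show "X xs = 0 xs" by simp
qed

definition NR_op :: "nat \<Rightarrow> nat \<Rightarrow> ('v list \<Rightarrow> 'v) \<Rightarrow> ('v list \<Rightarrow> 'v) \<Rightarrow> 'v list \<Rightarrow> 'v" where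
  "NR_op a b P Q = iota a P Q - sign_act (a * b) (iota b Q P)"

lemma NR_op_cochain:
  "P \<in> cochains (Suc a) \<Longrightarrow> Q \<in> cochains (Suc b) \<Longrightarrow> NR_op a b P Q \<in> cochains (Suc (a + b))"
  unfolding NR_op_def
  by (metis add.commute cochains_minus cochains_sign_act iota_cochain)

text \<open>
  The pre-Lie identity says that the graded commutator of \<open>i\<^sub>P\<close> and \<open>i\<^sub>Q\<close> is insertion of their
  Nijenhuis-Richardson bracket.
\<close>

lemma iota_NR_op:
  assumes P: "P \<in> cochains (Suc a)" and Q: "Q \<in> cochains (Suc b)" and R: "R \<in> cochains (Suc c)"
  shows "iota (a + b) (NR_op a b P Q) R = iota a P (iota b Q R) - sign_act (a * b) (iota b Q (iota a P R))"
  using iota_commutator[OF P Q R] cochains_multilinear[OF R]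
  by (simp add: NR_op_def iota_diff_left iota_sign_act_left sign_act_diff algebra_simps)

text \<open>
  Every insertion of a bracket is a commutator of insertions by \<open>iota_NR_op\<close>. All terms become
  double insertions, which cancel for each choice of parities.
\<close>

lemma NR_op_jacobi:
  assumes P: "P \<in> cochains (Suc a)" and Q: "Q \<in> cochains (Suc b)" and R: "R \<in> cochains (Suc c)"
  shows "NR_op a (b + c) P (NR_op b c Q R) = NR_op (a + b) c (NR_op a b P Q) R + sign_act (a * b) (NR_op b (a + c) Q (NR_op a c P R))"
  unfolding NR_op_def[of a "b + c"] NR_op_def[of "a + b" c] NR_op_def[of b "a + c"]
    iota_NR_op[OF P Q R] iota_NR_op[OF Q R P] iota_NR_op[OF P R Q]
  unfolding NR_op_def iota_diff_right iota_sign_act_right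
  by (cases "even a"; cases "even b"; cases "even c") (simp_all add: sign_act_def algebra_simps)

text \<open>
  The differential \<open>\<delta>\<close> expressed by insertions; \<open>delta_hom_eq_coboundary\<close> below shows that this is
  the usual formula.
\<close>

definition coboundary :: "nat \<Rightarrow> ('v list \<Rightarrow> 'v) \<Rightarrow> 'v list \<Rightarrow> 'v" where
  "coboundary a P = sign_act a (iota a P lie_cochain) - iota 1 lie_cochain P"

lemma lie_cochain_Suc: "lie_cochain \<in> cochains (Suc 1)"
  using lie_cochain_cochain by (simp add: numeral_2_eq_2)

lemma lie_cochain_multilinear: "multilinear lie_cochain"
  using lie_cochain_Suc by (rule cochains_multilinear)

lemma coboundary_cochain: "P \<in> cochains (Suc a) \<Longrightarrow> coboundary a P \<in> cochains (Suc (Suc a))"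
  using iota_cochain[of P a lie_cochain 1] iota_cochain[of lie_cochain 1 P a] lie_cochain_Suc
  by (simp add: coboundary_def cochains_minus cochains_sign_act)

lemma coboundary_eq_NR_op: "coboundary a P = - NR_op 1 a lie_cochain P"
  by (simp add: coboundary_def NR_op_def)

text \<open>
  The equation \<open>i\<^sub>\<mu> \<mu> = 0\<close> is the Hom-Jacobi identity.
\<close>

lemma iota_lie_lie: "iota 1 lie_cochain lie_cochain = 0"
proof
  fix xs
  show "iota 1 lie_cochain lie_cochain xs = 0 xs"
  proof (cases "length xs = 3")
    case True
    then obtain x y z where xs: "xs = [x, y, z]" by (auto simp: length_Suc_conv numeral_3_eq_3)
    show ?thesis
      using hom_leibniz[of x y z] unfolding lie_skew[of "\<alpha> x" "lie y z"] lie_skew[of "\<alpha> y" "lie x z"]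
      by (simp add: xs iota_def sign_act_def algebra_simps)
  next
    case False
    have "iota 1 lie_cochain lie_cochain \<in> cochains (Suc (1 + 1))"
      by (intro iota_cochain lie_cochain_Suc)
    from cochains_length[OF this] False show ?thesis by simp
  qed
qed

lemma coboundary_add: "coboundary a (P + Q) = coboundary a P + coboundary a Q"
  by (simp add: coboundary_def iota_add_left iota_add_right lie_cochain_multilinear sign_act_add)

lemma coboundary_diff: "coboundary a (P - Q) = coboundary a P - coboundary a Q"
  using coboundary_add[of a "P - Q" Q] by (simp add: eq_diff_eq)

lemma coboundary_zero [simp]: "coboundary a 0 = 0"
  using coboundary_diff[of a 0 0] by simp

lemma coboundary_sign_act: "coboundary a (sign_act k P) = sign_act k (coboundary a P)"
  using coboundary_diff[of a 0 P] by (simp add: sign_act_def)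

text \<open>
  The Jacobi identity for \<open>\<mu>\<close>, \<open>\<mu>\<close>, \<open>P\<close> reads \<open>[\<mu>, [\<mu>, P]] = [[\<mu>, \<mu>], P] - [\<mu>, [\<mu>, P]]\<close> with
  \<open>[\<mu>, \<mu>] = 0\<close>, and 2 is invertible.
\<close>

lemma coboundary_coboundary:
  assumes P: "P \<in> cochains (Suc a)"
  shows "coboundary (Suc a) (coboundary a P) = 0"
proof -
  define X where "X = NR_op 1 (1 + a) lie_cochain (NR_op 1 a lie_cochain P)"
  have "NR_op 1 1 lie_cochain lie_cochain = 0"
    unfolding NR_op_def iota_lie_lie by simp
  moreover have "NR_op (1 + 1) a 0 P = 0"
    using cochains_multilinear[OF P] by (simp add: NR_op_def)
  ultimately have "X = 0 + sign_act (1 * 1) X"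
    unfolding X_def by (metis NR_op_jacobi[OF lie_cochain_Suc lie_cochain_Suc P])
  then have "X + X = 0" by (simp add: sign_act_def eq_neg_iff_add_eq_0)
  then have "X = 0" by (rule double_eq_0)
  moreover have "coboundary (Suc a) (coboundary a P) = - coboundary (Suc a) (NR_op 1 a lie_cochain P)"
    using coboundary_diff[of "Suc a" 0 "NR_op 1 a lie_cochain P"] unfolding coboundary_eq_NR_op[of a] by simp
  ultimately show ?thesis by (simp add: coboundary_eq_NR_op X_def)
qed

text \<open>
  The Jacobi identity for \<open>\<mu>\<close>, \<open>P\<close>, \<open>Q\<close>: in a graded Lie algebra the bracket with a fixed element is a
  derivation.
\<close>

lemma coboundary_NR_op:
  assumes P: "P \<in> cochains (Suc a)" and Q: "Q \<in> cochains (Suc b)"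
  shows "coboundary (a + b) (NR_op a b P Q) = NR_op (Suc a) b (coboundary a P) Q + sign_act a (NR_op a (Suc b) P (coboundary b Q))"
proof -
  note mP = cochains_multilinear[OF P] and mQ = cochains_multilinear[OF Q]
  have "NR_op (Suc a) b (coboundary a P) Q = - NR_op (1 + a) b (NR_op 1 a lie_cochain P) Q"
    using iota_diff_left[OF mQ, of "Suc a" 0] iota_diff_right[of b Q 0]
    by (simp add: coboundary_eq_NR_op NR_op_def[of "Suc a" b] sign_act_minus mQ)
  moreover have "NR_op a (Suc b) P (coboundary b Q) = - NR_op a (1 + b) P (NR_op 1 b lie_cochain Q)"
    using iota_diff_left[OF mP, of "Suc b" 0] iota_diff_right[of a P 0]
    by (simp add: coboundary_eq_NR_op NR_op_def[of a "Suc b"] sign_act_minus mP)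
  ultimately show ?thesis
    using NR_op_jacobi[OF lie_cochain_Suc P Q] by (simp add: coboundary_eq_NR_op sign_act_minus)
qed

text \<open>
  The Cartan type formula behind the Froelicher-Nijenhuis bracket. In the commutator of \<open>i\<^sub>P\<close> and
  \<open>\<delta>\<close>, the part of \<open>\<delta>\<close> that inserts into \<open>\<mu>\<close> yields the cup bracket by \<open>iota_iota_lie\<close>, and
  the part that inserts \<open>\<mu>\<close> yields insertion of \<open>[P, \<mu>] = \<plusminus> \<delta> P\<close> by \<open>iota_NR_op\<close>.
\<close>

lemma iota_coboundary:
  assumes P: "P \<in> cochains (Suc a)" and Q: "Q \<in> cochains (Suc b)"
  shows "iota a P (coboundary b Q) - sign_act a (coboundary (a + b) (iota a P Q)) =
    cup a b P Q + sign_act (Suc a) (iota (Suc a) (coboundary a P) Q)"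
proof -
  have "iota (Suc a) (coboundary a P) Q = sign_act a (iota (a + 1) (NR_op a 1 P lie_cochain) Q)"
    by (simp add: coboundary_def NR_op_def sign_act_diff sign_act_sign_act iota_diff_left iota_sign_act_left cochains_multilinear[OF Q])
      (simp add: sign_act_def)
  also have "iota (a + 1) (NR_op a 1 P lie_cochain) Q =
      iota a P (iota 1 lie_cochain Q) - sign_act (a * 1) (iota 1 lie_cochain (iota a P Q))"
    by (rule iota_NR_op[OF P lie_cochain_Suc Q])
  finally have *: "iota (Suc a) (coboundary a P) Q =
      sign_act a (iota a P (iota 1 lie_cochain Q)) - iota 1 lie_cochain (iota a P Q)"
    by (cases "even a") (simp_all add: sign_act_def fun_eq_iff)
  show ?thesis
    unfolding * unfolding coboundary_def iota_diff_right iota_sign_act_right iota_iota_lie[OF P Q]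
    by (cases "even a"; cases "even b") (simp_all add: sign_act_def)
qed

section \<open>The Froelicher-Nijenhuis bracket\<close>

definition FN_op :: "nat \<Rightarrow> nat \<Rightarrow> ('v list \<Rightarrow> 'v) \<Rightarrow> ('v list \<Rightarrow> 'v) \<Rightarrow> 'v list \<Rightarrow> 'v" where
  "FN_op a b P Q = cup a b P Q + sign_act (Suc a) (iota (Suc a) (coboundary a P) Q)
     - sign_act (Suc (Suc a) * Suc b) (iota (Suc b) (coboundary b Q) P)"

lemma FN_op_cochain:
  assumes P: "P \<in> cochains (Suc a)" and Q: "Q \<in> cochains (Suc b)"
  shows "FN_op a b P Q \<in> cochains (Suc (Suc (a + b)))"
  using cup_cochain[OF P Q] iota_cochain[OF coboundary_cochain[OF P] Q] iota_cochain[OF coboundary_cochain[OF Q] P]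
  unfolding FN_op_def by (intro cochains_minus cochains_add cochains_sign_act) (simp_all add: add.commute)

lemma FN_op_eq_NR_op_coboundary:
  assumes P: "P \<in> cochains (Suc a)" and Q: "Q \<in> cochains (Suc b)"
  shows "FN_op a b P Q = NR_op a (Suc b) P (coboundary b Q) + sign_act (Suc a) (coboundary (a + b) (iota a P Q))"
  using iota_coboundary[OF P Q]
  by (cases "even a"; cases "even b") (simp_all add: FN_op_def NR_op_def sign_act_def algebra_simps)

text \<open>
  By \<open>FN_op_eq_NR_op_coboundary\<close> only \<open>\<delta> [P, \<delta> Q]\<close> remains, and \<open>\<delta>\<close> is a derivation with
  \<open>\<delta> (\<delta> Q) = 0\<close>.
\<close>

lemma coboundary_FN_op:
  assumes P: "P \<in> cochains (Suc a)" and Q: "Q \<in> cochains (Suc b)"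
  shows "coboundary (Suc (a + b)) (FN_op a b P Q) = NR_op (Suc a) (Suc b) (coboundary a P) (coboundary b Q)"
  using coboundary_NR_op[OF P coboundary_cochain[OF Q]] coboundary_coboundary[OF Q] coboundary_coboundary[OF iota_cochain[OF P Q]] cochains_multilinear[OF P]
  by (simp add: FN_op_eq_NR_op_coboundary[OF P Q] coboundary_add coboundary_sign_act NR_op_def[of a "Suc (Suc b)"])

lemma FN_op_skew:
  assumes P: "P \<in> cochains (Suc a)" and Q: "Q \<in> cochains (Suc b)"
  shows "FN_op a b P Q = - sign_act (Suc a * Suc b) (FN_op b a Q P)"
  unfolding FN_op_def cup_skew[OF P Q]
  by (cases "even a"; cases "even b") (simp_all add: sign_act_def)

text \<open>
  The expansion of a double bracket into the three kinds of terms \<open>[P, [Q, R]\<^sub>C]\<^sub>C\<close>,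
  \<open>[P, i\<^bsub>\<delta> Q\<^esub> R]\<^sub>C\<close> and \<open>i\<^bsub>\<delta> P\<^esub> (i\<^bsub>\<delta> Q\<^esub> R)\<close>. Insertions always stand in the second
  argument of the cup bracket; with this normal form the Jacobi identity is a comparison of
  coefficients.
\<close>

lemma FN_op_FN_op:
  assumes P: "P \<in> cochains (Suc a)" and Q: "Q \<in> cochains (Suc b)" and R: "R \<in> cochains (Suc c)"
  shows "FN_op a (Suc (b + c)) P (FN_op b c Q R) =
      cup a (Suc (b + c)) P (cup b c Q R)
    + sign_act (Suc b) (cup a (Suc (b + c)) P (iota (Suc b) (coboundary b Q) R))
    - sign_act (Suc (Suc b) * Suc c) (cup a (Suc (b + c)) P (iota (Suc c) (coboundary c R) Q))
    + sign_act (Suc a) (- sign_act (Suc (Suc (a + b)) * Suc c) (cup c (Suc (a + b)) R (iota (Suc a) (coboundary a P) Q))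
        + sign_act (Suc a * Suc b) (cup b (Suc (a + c)) Q (iota (Suc a) (coboundary a P) R)))
    + sign_act (Suc a) (sign_act (Suc b) (iota (Suc a) (coboundary a P) (iota (Suc b) (coboundary b Q) R)))
    - sign_act (Suc a) (sign_act (Suc (Suc b) * Suc c) (iota (Suc a) (coboundary a P) (iota (Suc c) (coboundary c R) Q)))
    - sign_act (Suc (Suc a) * Suc (Suc (b + c)))
       (iota (Suc b) (coboundary b Q) (iota (Suc c) (coboundary c R) P)
        - sign_act (Suc b * Suc c) (iota (Suc c) (coboundary c R) (iota (Suc b) (coboundary b Q) P)))"
proof -
  \<comment> \<open>Morphism property, then the commutator formula for insertions.\<close>
  have 1: "iota (Suc (Suc (b + c))) (coboundary (Suc (b + c)) (FN_op b c Q R)) P =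
      iota (Suc b) (coboundary b Q) (iota (Suc c) (coboundary c R) P)
      - sign_act (Suc b * Suc c) (iota (Suc c) (coboundary c R) (iota (Suc b) (coboundary b Q) P))"
    using iota_NR_op[OF coboundary_cochain[OF Q] coboundary_cochain[OF R] P] by (simp add: coboundary_FN_op[OF Q R])
  \<comment> \<open>Skew-symmetry moves the inserted cochain to the second argument.\<close>
  have "cup (Suc (a + b)) c (iota (Suc a) (coboundary a P) Q) R =
      - sign_act (Suc (Suc (a + b)) * Suc c) (cup c (Suc (a + b)) R (iota (Suc a) (coboundary a P) Q))"
    using iota_cochain[OF coboundary_cochain[OF P] Q] by (intro cup_skew R) simp
  then have 2: "iota (Suc a) (coboundary a P) (cup b c Q R) =
      - sign_act (Suc (Suc (a + b)) * Suc c) (cup c (Suc (a + b)) R (iota (Suc a) (coboundary a P) Q))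
      + sign_act (Suc a * Suc b) (cup b (Suc (a + c)) Q (iota (Suc a) (coboundary a P) R))"
    using iota_cup[OF coboundary_cochain[OF P] Q R] by (simp add: add.commute)
  show ?thesis
    unfolding FN_op_def[of a "Suc (b + c)"] 1
    unfolding FN_op_def[of b c] cup_add_right cup_diff_right cup_sign_act_right iota_add_right iota_diff_right
      iota_sign_act_right 2 sign_act_add sign_act_diff
    by (simp add: algebra_simps)
qed

text \<open>
  Skew-symmetry brings the term \<open>[[P, Q], R]\<close> into the form \<open>[R, [P, Q]]\<close>, so that the same
  expansion applies to all three double brackets. What is left is the Jacobi identity for the cup
  bracket and a comparison of signs for each choice of parities.
\<close>

lemma FN_op_jacobi:
  assumes P: "P \<in> cochains (Suc a)" and Q: "Q \<in> cochains (Suc b)" and R: "R \<in> cochains (Suc c)"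
  shows "FN_op a (Suc (b + c)) P (FN_op b c Q R) = FN_op (Suc (a + b)) c (FN_op a b P Q) R
    + sign_act (Suc a * Suc b) (FN_op b (Suc (a + c)) Q (FN_op a c P R))"
proof -
  have "cup (Suc (a + b)) c (cup a b P Q) R = - sign_act (Suc (Suc (a + b)) * Suc c) (cup c (Suc (a + b)) R (cup a b P Q))"
    by (rule cup_skew[OF cup_cochain[OF P Q] R])
  note cj = cup_jacobi[OF P Q R, unfolded this]
  show ?thesis
    unfolding FN_op_skew[OF FN_op_cochain[OF P Q] R] FN_op_FN_op[OF P Q R] FN_op_FN_op[OF R P Q] FN_op_FN_op[OF Q P R] cj
    by (cases "even a"; cases "even b"; cases "even c")
      (simp_all add: sign_act_def algebra_simps)
qed

end

section \<open>The shuffle and coboundary formulas on homogeneous cochains\<close>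

lemma unshuffle_sum_left_empty: "unshuffle_sum xs (\<lambda>as bs. if as = [] then H bs else 0) = H xs"
proof (induction xs arbitrary: H)
  case (Cons x xs)
  have "unshuffle_sum xs (\<lambda>as bs. sign_act (length as) (if as = [] then H (x # bs) else 0)) =
      unshuffle_sum xs (\<lambda>as bs. if as = [] then H (x # bs) else 0)"
    by (rule unshuffle_sum_cong) (simp add: sign_act_def)
  then show ?case using Cons.IH[of "\<lambda>bs. H (x # bs)"] by simp
qed simp

text \<open>
  Choosing an entry to be taken out of a list is choosing a splitting whose first part has length
  one.
\<close>

lemma alternating_sum_eq_unshuffle_sum:
  "(\<Sum>i<length xs. sign_act i (G (xs ! i) (nths xs (- {i})))) =
   unshuffle_sum xs (\<lambda>as bs. case as of [x] \<Rightarrow> G x bs | _ \<Rightarrow> 0)"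
proof (induction xs arbitrary: G)
  case (Cons x xs)
  have tail: "nths (x # xs) (- {Suc i}) = x # nths xs (- {i})" for i
    by (simp add: nths_Cons) (rule arg_cong[where f = "nths xs"], auto)
  have head: "nths (x # xs) (- {0}) = xs"
    by (simp add: nths_Cons nths_all)
  have "(\<Sum>i<length xs. sign_act (Suc i) (G (xs ! i) (x # nths xs (- {i})))) =
      (\<Sum>i<length xs. sign_act i (- G (xs ! i) (x # nths xs (- {i}))))"
    by (intro sum.cong) (simp_all add: sign_act_def)
  also have "\<dots> = unshuffle_sum xs (\<lambda>as bs. case as of [y] \<Rightarrow> - G y (x # bs) | _ \<Rightarrow> 0)"
    by (rule Cons.IH)
  also have "\<dots> = unshuffle_sum xs (\<lambda>as bs. sign_act (length as) (case as of [y] \<Rightarrow> G y (x # bs) | _ \<Rightarrow> 0))"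
    by (rule arg_cong[where f = "unshuffle_sum xs"]) (auto simp: fun_eq_iff sign_act_def split: list.splits)
  finally have 1: "(\<Sum>i<length xs. sign_act (Suc i) (G (xs ! i) (x # nths xs (- {i})))) = \<dots>" .
  have "unshuffle_sum xs (\<lambda>as bs. case x # as of [y] \<Rightarrow> G y bs | _ \<Rightarrow> 0) =
      unshuffle_sum xs (\<lambda>as bs. if as = [] then G x bs else 0)"
    by (rule arg_cong[where f = "unshuffle_sum xs"]) (auto simp: fun_eq_iff split: list.splits)
  then have 2: "unshuffle_sum xs (\<lambda>as bs. case x # as of [y] \<Rightarrow> G y bs | _ \<Rightarrow> 0) = G x xs"
    by (simp only: unshuffle_sum_left_empty)
  show ?case
    unfolding unshuffle_sum.simps 2 1[symmetric] length_Cons sum.lessThan_Suc_shift tail head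
    by (simp add: sign_act_def[of 0])
qed simp

lemma pairs_less_Suc:
  "{(i, j). i < j \<and> j < Suc n} =
   (\<lambda>j. (0, Suc j)) ` {..<n} \<union> (\<lambda>(i, j). (Suc i, Suc j)) ` {(i, j). i < j \<and> j < n}"
proof (intro equalityI subsetI)
  fix p assume "p \<in> {(i, j). i < j \<and> j < Suc n}"
  then obtain i j where p: "p = (i, j)" "i < j" "j < Suc n" by auto
  then obtain j' where j: "j = Suc j'" by (cases j) auto
  show "p \<in> (\<lambda>j. (0, Suc j)) ` {..<n} \<union> (\<lambda>(i, j). (Suc i, Suc j)) ` {(i, j). i < j \<and> j < n}"
    using p j by (cases i) (auto simp: image_iff)
qed auto

lemma finite_pairs_less: "finite {(i, j). i < j \<and> j < (n :: nat)}"
  by (rule finite_subset[of _ "{..<n} \<times> {..<n}"]) auto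

text \<open>
  The analogue for the choice of two entries. The signs differ by \<open>-1\<close>: taking out the first two
  entries is the trivial splitting, of sign 1, but \<open>(-1)\<^bsup>0 + 1\<^esup> = -1\<close>.
\<close>

lemma alternating_pair_sum_eq_unshuffle_sum:
  "(\<Sum>(i, j)\<in>{(i, j). i < j \<and> j < length xs}. sign_act (i + j) (G (xs ! i) (xs ! j) (nths xs (- {i, j})))) =
   - unshuffle_sum xs (\<lambda>as bs. case as of [x, y] \<Rightarrow> G x y bs | _ \<Rightarrow> 0)"
proof (induction xs arbitrary: G)
  case (Cons x xs)
  let ?T = "\<lambda>(i, j). sign_act (i + j) (G ((x # xs) ! i) ((x # xs) ! j) (nths (x # xs) (- {i, j})))"
  have n0: "nths (x # xs) (- {0, Suc j}) = nths xs (- {j})" for j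
    by (simp add: nths_Cons) (rule arg_cong[where f = "nths xs"], auto)
  have nS: "nths (x # xs) (- {Suc i, Suc j}) = x # nths xs (- {i, j})" for i j
    by (simp add: nths_Cons) (rule arg_cong[where f = "nths xs"], auto)
  have "sum ?T {(i, j). i < j \<and> j < length (x # xs)} =
      sum ?T ((\<lambda>j. (0, Suc j)) ` {..<length xs}) +
      sum ?T ((\<lambda>(i, j). (Suc i, Suc j)) ` {(i, j). i < j \<and> j < length xs})"
    unfolding length_Cons pairs_less_Suc
    by (rule sum.union_disjoint) (auto simp: finite_pairs_less)
  also have "sum ?T ((\<lambda>j. (0, Suc j)) ` {..<length xs}) =
      (\<Sum>j<length xs. sign_act j (- G x (xs ! j) (nths xs (- {j}))))"
    by (subst sum.reindex) (auto simp: inj_on_def n0 sign_act_def intro!: sum.cong)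
  also have "\<dots> = - unshuffle_sum xs (\<lambda>as bs. case as of [y] \<Rightarrow> G x y bs | _ \<Rightarrow> 0)"
    unfolding alternating_sum_eq_unshuffle_sum[where G = "\<lambda>y bs. - G x y bs"] unshuffle_sum_minus[symmetric]
    by (rule arg_cong[where f = "unshuffle_sum xs"]) (auto simp: fun_eq_iff split: list.splits)
  also have "sum ?T ((\<lambda>(i, j). (Suc i, Suc j)) ` {(i, j). i < j \<and> j < length xs}) =
      (\<Sum>(i, j)\<in>{(i, j). i < j \<and> j < length xs}. sign_act (i + j) (G (xs ! i) (xs ! j) (x # nths xs (- {i, j}))))"
    by (subst sum.reindex) (auto simp: inj_on_def nS sign_act_def intro!: sum.cong)
  also have "\<dots> = - unshuffle_sum xs (\<lambda>as bs. case as of [y, z] \<Rightarrow> G y z (x # bs) | _ \<Rightarrow> 0)"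
    by (rule Cons.IH)
  also have "unshuffle_sum xs (\<lambda>as bs. case as of [y, z] \<Rightarrow> G y z (x # bs) | _ \<Rightarrow> 0) =
      unshuffle_sum xs (\<lambda>as bs. sign_act (length as) (case as of [y, z] \<Rightarrow> G y z (x # bs) | _ \<Rightarrow> 0))"
    by (rule arg_cong[where f = "unshuffle_sum xs"]) (auto simp: fun_eq_iff sign_act_def split: list.splits)
  also have "unshuffle_sum xs (\<lambda>as bs. case as of [y] \<Rightarrow> G x y bs | _ \<Rightarrow> 0) =
      unshuffle_sum xs (\<lambda>as bs. case x # as of [y, z] \<Rightarrow> G y z bs | _ \<Rightarrow> 0)"
    by (rule arg_cong[where f = "unshuffle_sum xs"]) (auto simp: fun_eq_iff split: list.splits)
  finally show ?case by simp
qed simp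

context hom_lie_algebra
begin

lemma scale_minus_one_power: "(- 1) ^ k *s v = sign_act k v"
  by (simp add: sign_act_def)

lemma ins_eq_iota:
  assumes P: "P \<in> cochains (Suc a)" and Q: "Q \<in> cochains (Suc b)"
  shows "ins (Suc a) (Suc b) P Q = iota a P Q"
proof
  fix xs
  let ?F = "\<lambda>as bs. Q (P as # map (\<alpha> ^^ a) bs)"
  show "ins (Suc a) (Suc b) P Q xs = iota a P Q xs"
  proof (cases "length xs = Suc a + b")
    case True
    have "map (\<lambda>i. (\<alpha> ^^ a) (xs ! \<sigma> i)) is = map (\<alpha> ^^ a) (map (\<lambda>i. xs ! \<sigma> i) is)" for \<sigma> :: "nat \<Rightarrow> nat" and "is"
      by simp
    then have "ins (Suc a) (Suc b) P Q xs = (\<Sum>\<sigma>\<in>shuffle_perms (Suc a) b. of_int (sign \<sigma>) *s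
        ?F (map (\<lambda>i. xs ! \<sigma> i) [0..<Suc a]) (map (\<lambda>i. xs ! \<sigma> i) [Suc a..<Suc a + b]))"
      using True by (simp add: ins_def del: map_map upt_Suc)
    also have "\<dots> = unshuffle_sum xs (\<lambda>as bs. if length as = Suc a \<and> length bs = b then ?F as bs else 0)"
      by (rule shuffle_sum_eq_unshuffle_sum[OF True])
    also have "\<dots> = unshuffle_sum xs ?F"
    proof (rule unshuffle_sum_cong)
      fix as bs :: "'v list" assume "length as + length bs = length xs"
      then have "length bs = b" if "length as = Suc a" using True that by simp
      moreover have "?F as bs = 0" if "length as \<noteq> Suc a"
        using cochains_length[OF P that] multilinear_hd_zero[OF cochains_multilinear[OF Q]] by simp
      ultimately show "(if length as = Suc a \<and> length bs = b then ?F as bs else 0) = ?F as bs" by auto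
    qed
    finally show ?thesis by (simp add: iota_def)
  next
    case False
    then show ?thesis using cochains_length[OF iota_cochain[OF P Q]] by (simp add: ins_def)
  qed
qed

lemma C_bracket_eq_cup:
  assumes P: "P \<in> cochains (Suc a)" and Q: "Q \<in> cochains (Suc b)"
  shows "C_bracket (Suc a) (Suc b) P Q = cup a b P Q"
proof
  fix xs
  let ?F = "\<lambda>as bs. lie ((\<alpha> ^^ b) (P as)) ((\<alpha> ^^ a) (Q bs))"
  show "C_bracket (Suc a) (Suc b) P Q xs = cup a b P Q xs"
  proof (cases "length xs = Suc a + Suc b")
    case True
    have "C_bracket (Suc a) (Suc b) P Q xs =
        unshuffle_sum xs (\<lambda>as bs. if length as = Suc a \<and> length bs = Suc b then ?F as bs else 0)"
      using True shuffle_sum_eq_unshuffle_sum[OF True, of ?F] by (simp add: C_bracket_def del: upt_Suc)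
    also have "\<dots> = unshuffle_sum xs ?F"
      using cochains_length[OF P] cochains_length[OF Q] by (intro unshuffle_sum_cong) auto
    finally show ?thesis by (simp add: cup_def)
  next
    case False
    then show ?thesis using cochains_length[OF cup_cochain[OF P Q]] by (simp add: C_bracket_def)
  qed
qed

text \<open>
  The first sum of the differential is \<open>\<plusminus> i\<^sub>P \<mu>\<close>, after exchanging the two blocks of the
  unshuffle and the two arguments of the Lie bracket, and the second sum is \<open>- i\<^sub>\<mu> P\<close>.
\<close>

lemma delta_hom_eq_coboundary:
  assumes P: "P \<in> cochains (Suc a)"
  shows "delta_hom (Suc a) P = coboundary a P"
proof
  fix xs
  show "delta_hom (Suc a) P xs = coboundary a P xs"
  proof (cases "length xs = Suc (Suc a)")
    case True
    have "sign_act (length as * length bs) (lie_cochain (P as # map (\<alpha> ^^ a) bs)) =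
        sign_act a (case bs of [x] \<Rightarrow> lie ((\<alpha> ^^ a) x) (P as) | _ \<Rightarrow> 0)" for as bs
    proof (cases "length as = Suc a")
      case True
      show ?thesis
      proof (cases "length bs = 1")
        case l: True
        then obtain x where "bs = [x]" by (auto simp: length_Suc_conv)
        then show ?thesis using True lie_skew[of "P as" "(\<alpha> ^^ a) x"] by (simp add: sign_act_def)
      next
        case False
        then show ?thesis by (auto simp: lie_cochain_length split: list.splits)
      qed
    next
      case False
      then show ?thesis
        using cochains_length[OF P False] multilinear_hd_zero[OF lie_cochain_multilinear]
        by (simp split: list.splits)
    qed
    note * = this
    have "iota a P lie_cochain xs = sign_act a (unshuffle_sum xs (\<lambda>bs as. case bs of [x] \<Rightarrow> lie ((\<alpha> ^^ a) x) (P as) | _ \<Rightarrow> 0))"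
      unfolding iota_def by (subst unshuffle_sum_cocomm) (simp only: * unshuffle_sum_sign_act)
    then have 1: "sign_act a (iota a P lie_cochain xs) =
        (\<Sum>i<length xs. sign_act i (lie ((\<alpha> ^^ a) (xs ! i)) (P (nths xs (- {i})))))"
      unfolding alternating_sum_eq_unshuffle_sum[where G = "\<lambda>x bs. lie ((\<alpha> ^^ a) x) (P bs)"] by (simp add: sign_act_def)
    have "P (lie_cochain as # map \<alpha> bs) = (case as of [x, y] \<Rightarrow> P (lie x y # map \<alpha> bs) | _ \<Rightarrow> 0)" for as bs
      using multilinear_hd_zero[OF cochains_multilinear[OF P]]
      by (auto simp: lie_cochain_def split: list.splits)
    then have "iota 1 lie_cochain P xs = unshuffle_sum xs (\<lambda>as bs. case as of [x, y] \<Rightarrow> P (lie x y # map \<alpha> bs) | _ \<Rightarrow> 0)"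
      by (simp add: iota_def)
    then have 2: "- iota 1 lie_cochain P xs =
        (\<Sum>(i, j)\<in>{(i, j). i < j \<and> j < length xs}. sign_act (i + j) (P (lie (xs ! i) (xs ! j) # map \<alpha> (nths xs (- {i, j})))))"
      unfolding alternating_pair_sum_eq_unshuffle_sum[where G = "\<lambda>x y bs. P (lie x y # map \<alpha> bs)"] by simp
    have "coboundary a P xs = sign_act a (iota a P lie_cochain xs) + - iota 1 lie_cochain P xs"
      by (simp add: coboundary_def sign_act_apply)
    then show ?thesis
      unfolding 1 2 using True by (simp add: delta_hom_def scale_minus_one_power)
  next
    case False
    then show ?thesis using cochains_length[OF coboundary_cochain[OF P]] by (simp add: delta_hom_def)
  qed
qed

lemma NR_hom_eq_NR_op:
  assumes P: "P \<in> cochains (Suc a)" and Q: "Q \<in> cochains (Suc b)"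
  shows "NR_hom (Suc a) (Suc b) P Q = NR_op a b P Q"
  by (simp add: NR_hom_def NR_op_def ins_eq_iota[OF P Q] ins_eq_iota[OF Q P] cscale_sign)

lemma FN_hom_eq_FN_op:
  assumes P: "P \<in> cochains (Suc a)" and Q: "Q \<in> cochains (Suc b)"
  shows "FN_hom (Suc a) (Suc b) P Q = FN_op a b P Q"
  unfolding FN_hom_def FN_op_def C_bracket_eq_cup[OF P Q] delta_hom_eq_coboundary[OF P] delta_hom_eq_coboundary[OF Q] cscale_sign
  using ins_eq_iota[OF coboundary_cochain[OF P] Q] ins_eq_iota[OF coboundary_cochain[OF Q] P] by simp

lemma iota_scale_right: "iota a P (cscale c Q) = cscale c (iota a P Q)"
  by (auto simp: iota_def cscale_def scale_unshuffle_sum)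

lemma iota_scale_left:
  assumes "multilinear Q"
  shows "iota a (cscale c P) Q = cscale c (iota a P Q)"
proof -
  have "Q (c *s x # xs) = c *s Q (x # xs)" for x xs
    using multilinearD[OF assms, of "[]" xs] by (simp add: lin_iff)
  then show ?thesis by (simp add: iota_def cscale_def scale_unshuffle_sum)
qed

lemma lie_scale: "lie (c *s x) y = c *s lie x y" "lie x (c *s y) = c *s lie x y"
  using lie_linear_left[of y] lie_linear_right[of x] by (simp_all add: lin_iff)

lemma alpha_power_scale: "(\<alpha> ^^ k) (c *s x) = c *s (\<alpha> ^^ k) x"
  using lin_alpha_power[of k] by (simp add: lin_iff)

lemma cup_scale: "cup a b (cscale c P) Q = cscale c (cup a b P Q)" "cup a b P (cscale c Q) = cscale c (cup a b P Q)"
  by (simp_all add: cup_def cscale_def scale_unshuffle_sum alpha_power_scale lie_scale)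

lemma cscale_right_distrib: "cscale c (f + g) = cscale c f + cscale c g"
  "cscale c (f - g) = cscale c f - cscale c g" "cscale c (sign_act k f) = sign_act k (cscale c f)"
  by (auto simp: cscale_def fun_eq_iff scale_right_distrib scale_right_diff_distrib sign_act_def)

lemma coboundary_scale: "coboundary a (cscale c P) = cscale c (coboundary a P)"
  by (simp add: coboundary_def iota_scale_left iota_scale_right lie_cochain_multilinear cscale_right_distrib)

lemma vector_space_cscale: "vector_space cscale"
  by unfold_locales
    (auto simp: cscale_def scale_right_distrib scale_left_distrib)

end

section \<open>Finite sums of homogeneous cochains\<close>

lemma hpart_add: "hpart m (f + g) = hpart m f + hpart m g"
  by (auto simp: hpart_def)

lemma hpart_zero [simp]: "hpart m 0 = 0"
  by (auto simp: hpart_def)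

lemma extend2_zero: "extend2 B 0 g = 0" "extend2 B f 0 = 0"
  by (simp_all add: extend2_def)

lemma hpart_sum: "hpart m (\<Sum>i\<in>I. f i) = (\<Sum>i\<in>I. hpart m (f i))"
  by (rule additive.sum[of "hpart m" f I]) (unfold_locales, rule hpart_add)

context hom_lie_algebra
begin

lemma C_Hom_0 [simp]: "C_Hom 0 = {0}"
  by (simp add: C_Hom_def)

lemma C_Hom_Suc [simp]: "C_Hom (Suc n) = cochains (Suc n)"
  by (simp add: C_Hom_def)

lemma C_Hom_subset_cochains: "f \<in> C_Hom n \<Longrightarrow> f \<in> cochains n"
  by (auto simp: C_Hom_def cochains_zero split: if_splits)

lemma C_Hom_zero: "0 \<in> C_Hom n"
  by (simp add: C_Hom_def cochains_zero)

lemma C_Hom_add: "f \<in> C_Hom n \<Longrightarrow> g \<in> C_Hom n \<Longrightarrow> f + g \<in> C_Hom n"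
  by (auto simp: C_Hom_def cochains_add split: if_splits)

lemma cscale_zero [simp]: "cscale c 0 = 0"
  by (auto simp: cscale_def)

lemma C_Hom_cscale: "f \<in> C_Hom n \<Longrightarrow> cscale c f \<in> C_Hom n"
  by (auto simp: C_Hom_def cochains_cscale split: if_splits)

lemma hpart_cscale: "hpart m (cscale c f) = cscale c (hpart m f)"
  by (auto simp: hpart_def cscale_def)

lemma hpart_C_Hom: "f \<in> C_Hom n \<Longrightarrow> hpart m f = (if m = n then f else 0)"
  using cochains_length[OF C_Hom_subset_cochains, of f n] by (auto simp: hpart_def fun_eq_iff)

abbreviation cochain_space :: "('v list \<Rightarrow> 'v) set" where
  "cochain_space \<equiv> module.span cscale (\<Union>n. C_Hom n)"

lemma subspace_C_Hom: "module.subspace cscale (C_Hom n)"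
proof -
  interpret V: vector_space cscale by (rule vector_space_cscale)
  show ?thesis by (rule V.subspaceI) (simp_all add: C_Hom_zero C_Hom_add C_Hom_cscale)
qed

text \<open>
  The maps on lists with finitely many nonzero homogeneous parts, all of which are cochains, form a
  subspace that contains every \<open>C_Hom n\<close>, hence the span. This makes the sums in \<open>extend1\<close> and
  \<open>extend2\<close> finite sums over cochains.
\<close>

lemma cochain_space_hpart:
  assumes "f \<in> cochain_space"
  shows "finite {m. hpart m f \<noteq> 0}" "hpart m f \<in> C_Hom m"
proof -
  interpret V: vector_space cscale by (rule vector_space_cscale)
  let ?S = "{f. finite {m. hpart m f \<noteq> 0} \<and> (\<forall>m. hpart m f \<in> C_Hom m)}"
  have "cochain_space \<subseteq> ?S"
  proof (rule V.span_minimal)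
    show "(\<Union>n. C_Hom n) \<subseteq> ?S"
    proof
      fix f assume "f \<in> (\<Union>n. C_Hom n)"
      then obtain n where f: "f \<in> C_Hom n" by blast
      have "finite {m. hpart m f \<noteq> 0}"
        by (rule finite_subset[of _ "{n}"]) (auto simp: hpart_C_Hom[OF f])
      moreover have "hpart m f \<in> C_Hom m" for m
        using f C_Hom_zero by (simp add: hpart_C_Hom[OF f])
      ultimately show "f \<in> ?S" by simp
    qed
    show "V.subspace ?S"
    proof (rule V.subspaceI)
      fix f g assume "f \<in> ?S" "g \<in> ?S"
      moreover from this have "finite {m. hpart m (f + g) \<noteq> 0}"
        by (intro finite_subset[where B = "{m. hpart m f \<noteq> 0} \<union> {m. hpart m g \<noteq> 0}" and A = "{m. hpart m (f + g) \<noteq> 0}"])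
          (auto simp: hpart_add)
      ultimately show "f + g \<in> ?S" by (simp add: hpart_add C_Hom_add)
    next
      fix c f assume "f \<in> ?S"
      moreover from this have "finite {m. hpart m (cscale c f) \<noteq> 0}"
        by (intro finite_subset[where B = "{m. hpart m f \<noteq> 0}" and A = "{m. hpart m (cscale c f) \<noteq> 0}"])
          (auto simp: hpart_cscale)
      ultimately show "cscale c f \<in> ?S" by (simp add: hpart_cscale C_Hom_cscale)
    qed (simp add: C_Hom_zero)
  qed
  then show "finite {m. hpart m f \<noteq> 0}" "hpart m f \<in> C_Hom m" using assms by auto
qed

text \<open>
  Additive statements on the span need to be checked on homogeneous elements only.
\<close>

lemma cochain_space_induct [consumes 1, case_names zero homogeneous add]:
  assumes "f \<in> cochain_space" "Z 0" "\<And>f n. f \<in> C_Hom n \<Longrightarrow> Z f"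
    "\<And>f g. f \<in> cochain_space \<Longrightarrow> g \<in> cochain_space \<Longrightarrow> Z f \<Longrightarrow> Z g \<Longrightarrow> Z (f + g)"
  shows "Z f"
proof -
  interpret V: vector_space cscale by (rule vector_space_cscale)
  have "f \<in> cochain_space \<and> Z f"
    using assms(1)
  proof (induction rule: V.span_induct_alt)
    case base
    show ?case by (intro conjI V.span_zero assms(2))
  next
    case (step c x y)
    then obtain n where n: "cscale c x \<in> C_Hom n" using C_Hom_cscale by blast
    then have cx: "cscale c x \<in> cochain_space" by (intro V.span_base UN_I[of n]) simp_all
    have "cscale c x + y \<in> cochain_space" "Z (cscale c x + y)"
      using step.IH by (blast intro: V.span_add cx assms(4) assms(3)[OF n])+
    then show ?case by (rule conjI)
  qed
  then show ?thesis ..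
qed

text \<open>
  Bilinearity of a family of operations in each pair of arities, as far as it matters for
  \<open>extend2\<close>: the arguments are cochains of the arities with which the operation is called.
\<close>

definition bilinear_family ::
    "(nat \<Rightarrow> nat \<Rightarrow> ('v list \<Rightarrow> 'v) \<Rightarrow> ('v list \<Rightarrow> 'v) \<Rightarrow> 'v list \<Rightarrow> 'v) \<Rightarrow> bool" where
  "bilinear_family B \<longleftrightarrow>
    (\<forall>m n f g h. f \<in> C_Hom m \<longrightarrow> g \<in> C_Hom m \<longrightarrow> h \<in> C_Hom n \<longrightarrow>
      B m n (f + g) h = B m n f h + B m n g h) \<and>
    (\<forall>m n f g h. f \<in> C_Hom m \<longrightarrow> g \<in> C_Hom n \<longrightarrow> h \<in> C_Hom n \<longrightarrow>
      B m n f (g + h) = B m n f g + B m n f h) \<and>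
    (\<forall>m n c f g. f \<in> C_Hom m \<longrightarrow> g \<in> C_Hom n \<longrightarrow> B m n (cscale c f) g = cscale c (B m n f g)) \<and>
    (\<forall>m n c f g. f \<in> C_Hom m \<longrightarrow> g \<in> C_Hom n \<longrightarrow> B m n f (cscale c g) = cscale c (B m n f g))"

lemma bilinear_familyD:
  assumes "bilinear_family B"
  shows "f \<in> C_Hom m \<Longrightarrow> g \<in> C_Hom m \<Longrightarrow> h \<in> C_Hom n \<Longrightarrow> B m n (f + g) h = B m n f h + B m n g h"
    and "f \<in> C_Hom m \<Longrightarrow> g \<in> C_Hom n \<Longrightarrow> h \<in> C_Hom n \<Longrightarrow> B m n f (g + h) = B m n f g + B m n f h"
    and "f \<in> C_Hom m \<Longrightarrow> g \<in> C_Hom n \<Longrightarrow> B m n (cscale c f) g = cscale c (B m n f g)"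
    and "f \<in> C_Hom m \<Longrightarrow> g \<in> C_Hom n \<Longrightarrow> B m n f (cscale c g) = cscale c (B m n f g)"
  using assms unfolding bilinear_family_def by blast+

lemma bilinear_family_zero:
  assumes "bilinear_family B"
  shows "g \<in> C_Hom n \<Longrightarrow> B m n 0 g = 0" "f \<in> C_Hom m \<Longrightarrow> B m n f 0 = 0"
proof -
  have z: "cscale 0 f = 0" for f by (auto simp: cscale_def)
  show "g \<in> C_Hom n \<Longrightarrow> B m n 0 g = 0"
    using assms C_Hom_zero[of m] unfolding bilinear_family_def by (metis z)
  show "f \<in> C_Hom m \<Longrightarrow> B m n f 0 = 0"
    using assms C_Hom_zero[of n] unfolding bilinear_family_def by (metis z)
qed

text \<open>
  Summing over any finite set that contains the support makes sums over different supports
  comparable, which is what additivity of the extension needs.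
\<close>

lemma extend2_superset:
  assumes B: "bilinear_family B" and f: "f \<in> cochain_space" and g: "g \<in> cochain_space"
    and M: "finite M" "{m. hpart m f \<noteq> 0} \<subseteq> M" and N: "finite N" "{n. hpart n g \<noteq> 0} \<subseteq> N"
  shows "extend2 B f g = (\<Sum>m\<in>M. \<Sum>n\<in>N. B m n (hpart m f) (hpart n g))"
proof -
  note hf = cochain_space_hpart(2)[OF f] and hg = cochain_space_hpart(2)[OF g]
  have "extend2 B f g = (\<Sum>m | hpart m f \<noteq> 0. \<Sum>n\<in>N. B m n (hpart m f) (hpart n g))"
    unfolding extend2_def using N bilinear_family_zero(2)[OF B hf]
    by (intro sum.cong refl sum.mono_neutral_left) auto
  also have "\<dots> = (\<Sum>m\<in>M. \<Sum>n\<in>N. B m n (hpart m f) (hpart n g))"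
    using M bilinear_family_zero(1)[OF B hg]
    by (intro sum.mono_neutral_left) auto
  finally show ?thesis .
qed

lemma extend2_homogeneous:
  assumes B: "bilinear_family B" and f: "f \<in> C_Hom m" and g: "g \<in> C_Hom n"
  shows "extend2 B f g = B m n f g"
proof -
  interpret V: vector_space cscale by (rule vector_space_cscale)
  have "f \<in> cochain_space" "g \<in> cochain_space" using f g by (blast intro: V.span_base)+
  then have "extend2 B f g = (\<Sum>i\<in>{m}. \<Sum>j\<in>{n}. B i j (hpart i f) (hpart j g))"
    by (intro extend2_superset[OF B]) (auto simp: hpart_C_Hom[OF f] hpart_C_Hom[OF g])
  then show ?thesis by (simp add: hpart_C_Hom[OF f] hpart_C_Hom[OF g])
qed

lemma extend2_bilinear:
  assumes B: "bilinear_family B" and f: "f \<in> cochain_space" and g: "g \<in> cochain_space" and h: "h \<in> cochain_space"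
  shows "extend2 B (f + g) h = extend2 B f h + extend2 B g h"
    and "extend2 B h (f + g) = extend2 B h f + extend2 B h g"
    and "extend2 B (cscale c f) g = cscale c (extend2 B f g)"
    and "extend2 B f (cscale c g) = cscale c (extend2 B f g)"
proof -
  interpret V: vector_space cscale by (rule vector_space_cscale)
  note fin = cochain_space_hpart(1) and hp = cochain_space_hpart(2)
  \<comment> \<open>A common index set for the supports of all arguments.\<close>
  define N where "N = {m. hpart m f \<noteq> 0} \<union> {m. hpart m g \<noteq> 0} \<union> {m. hpart m h \<noteq> 0}"
  have N: "finite N" unfolding N_def using fin f g h by blast
  have sub: "{m. hpart m f \<noteq> 0} \<subseteq> N" "{m. hpart m g \<noteq> 0} \<subseteq> N" "{m. hpart m h \<noteq> 0} \<subseteq> N"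
    "{m. hpart m (f + g) \<noteq> 0} \<subseteq> N" "{m. hpart m (cscale c f) \<noteq> 0} \<subseteq> N" "{m. hpart m (cscale c g) \<noteq> 0} \<subseteq> N"
    by (auto simp: N_def hpart_add hpart_cscale)
  have fg: "f + g \<in> cochain_space" and cf: "cscale c f \<in> cochain_space" and cg: "cscale c g \<in> cochain_space"
    using f g by (auto intro: V.span_add V.span_scale)
  note E = extend2_superset[OF B _ _ N _ N]
  show "extend2 B (f + g) h = extend2 B f h + extend2 B g h"
    unfolding E[OF fg h sub(4,3)] E[OF f h sub(1,3)] E[OF g h sub(2,3)] hpart_add sum.distrib[symmetric]
    by (intro sum.cong refl bilinear_familyD[OF B] hp f g h)
  show "extend2 B h (f + g) = extend2 B h f + extend2 B h g"
    unfolding E[OF h fg sub(3,4)] E[OF h f sub(3,1)] E[OF h g sub(3,2)] hpart_add sum.distrib[symmetric]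
    by (intro sum.cong refl bilinear_familyD[OF B] hp f g h)
  show "extend2 B (cscale c f) g = cscale c (extend2 B f g)"
    unfolding E[OF cf g sub(5,2)] E[OF f g sub(1,2)] hpart_cscale V.scale_sum_right
    by (intro sum.cong refl bilinear_familyD[OF B] hp f g)
  show "extend2 B f (cscale c g) = cscale c (extend2 B f g)"
    unfolding E[OF f cg sub(1,6)] E[OF f g sub(1,2)] hpart_cscale V.scale_sum_right
    by (intro sum.cong refl bilinear_familyD[OF B] hp f g)
qed

text \<open>
  The axioms of a graded Lie algebra need to be checked for homogeneous elements only. The shift
  \<open>s\<close> is the difference between arity and degree: 0 for the Froelicher-Nijenhuis and 1 for the
  Nijenhuis-Richardson algebra. Both gradings span the same space of cochains, because
  \<open>C_Hom 0 = {0}\<close>.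
\<close>

lemma graded_lie_algebra_extend2:
  assumes B: "bilinear_family B"
    and L: "\<And>n. L n = C_Hom (n + s)" "s \<le> 1"
    and degree: "\<And>m n f g. f \<in> C_Hom (m + s) \<Longrightarrow> g \<in> C_Hom (n + s) \<Longrightarrow> B (m + s) (n + s) f g \<in> C_Hom (m + n + s)"
    and skew: "\<And>m n f g. f \<in> C_Hom (m + s) \<Longrightarrow> g \<in> C_Hom (n + s) \<Longrightarrow>
      B (m + s) (n + s) f g = - sign_act (m * n) (B (n + s) (m + s) g f)"
    and jacobi: "\<And>m n p f g h. f \<in> C_Hom (m + s) \<Longrightarrow> g \<in> C_Hom (n + s) \<Longrightarrow> h \<in> C_Hom (p + s) \<Longrightarrow>
      B (m + s) (n + p + s) f (B (n + s) (p + s) g h) = B (m + n + s) (p + s) (B (m + s) (n + s) f g) h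
        + sign_act (m * n) (B (n + s) (m + p + s) g (B (m + s) (p + s) f h))"
  shows "graded_lie_algebra cscale L (extend2 B)"
proof -
  interpret V: vector_space cscale by (rule vector_space_cscale)
  have span: "V.span (\<Union>n. L n) = cochain_space"
  proof (rule V.span_eq[THEN iffD2], intro conjI)
    show "(\<Union>n. L n) \<subseteq> cochain_space" unfolding L by (blast intro: V.span_base)
    have "C_Hom n \<subseteq> V.span (\<Union>n. L n)" for n
    proof (cases n)
      case (Suc k)
      then have "C_Hom n = L (n - s)" unfolding L(1) using L(2) by simp
      then show ?thesis by (blast intro: V.span_base)
    qed (simp add: V.span_zero)
    then show "(\<Union>n. C_Hom n) \<subseteq> V.span (\<Union>n. L n)" by blast
  qed
  note hom = extend2_homogeneous[OF B]
  show "graded_lie_algebra cscale L (extend2 B)"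
  proof unfold_locales
    show "V.subspace (L n)" for n unfolding L by (rule subspace_C_Hom)
  next
    fix I :: "nat set" and u i
    assume u: "finite I" "\<And>n. n \<in> I \<Longrightarrow> u n \<in> L n" "(\<Sum>n\<in>I. u n) = 0" "i \<in> I"
    have "0 = hpart (i + s) (\<Sum>n\<in>I. u n)" using u(3) by simp
    also have "\<dots> = (\<Sum>n\<in>I. if n = i then u n else 0)"
      unfolding hpart_sum
    proof (rule sum.cong[OF refl])
      fix n assume "n \<in> I"
      then have "u n \<in> C_Hom (n + s)" using u(2) unfolding L by blast
      then show "hpart (i + s) (u n) = (if n = i then u n else 0)" by (simp add: hpart_C_Hom)
    qed
    also have "\<dots> = u i" using u(1,4) by simp
    finally show "u i = 0" by simp
  next
    fix x y m n assume xy: "x \<in> L m" "y \<in> L n"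
    note xy' = xy[unfolded L]
    show "extend2 B x y \<in> L (m + n)" using degree[OF xy'] by (simp add: L hom[OF xy'])
    show "extend2 B x y = - cscale ((- 1) ^ (m * n)) (extend2 B y x)"
      using skew[OF xy'] by (simp add: hom[OF xy'] hom[OF xy'(2,1)] cscale_sign)
    fix z p assume z: "z \<in> L p"
    note z' = z[unfolded L]
    show "extend2 B x (extend2 B y z) =
        extend2 B (extend2 B x y) z + cscale ((- 1) ^ (m * n)) (extend2 B y (extend2 B x z))"
      unfolding hom[OF xy'] hom[OF xy'(2) z'] hom[OF xy'(1) z'] hom[OF xy'(1) degree[OF xy'(2) z']]
        hom[OF degree[OF xy'] z'] hom[OF xy'(2) degree[OF xy'(1) z']] cscale_sign
      by (rule jacobi[OF xy' z'])
  qed (simp_all only: span extend2_bilinear[OF B])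
qed

lemma ins_zero: "Q \<in> cochains k \<Longrightarrow> ins m n 0 Q = 0" "ins m n P 0 = 0"
  using multilinear_hd_zero[OF cochains_multilinear, of Q k] by (auto simp: ins_def fun_eq_iff)

lemma C_bracket_zero: "C_bracket m n 0 Q = 0" "C_bracket m n P 0 = 0"
  by (auto simp: C_bracket_def)

lemma delta_hom_zero: "delta_hom m 0 = 0"
  by (auto simp: delta_hom_def)

lemma NR_hom_zero: "Q \<in> cochains n \<Longrightarrow> NR_hom m n 0 Q = 0" "P \<in> cochains m \<Longrightarrow> NR_hom m n P 0 = 0"
  by (simp_all add: NR_hom_def ins_zero)

lemma FN_hom_zero: "Q \<in> cochains n \<Longrightarrow> FN_hom m n 0 Q = 0" "P \<in> cochains m \<Longrightarrow> FN_hom m n P 0 = 0"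
  by (simp_all add: FN_hom_def C_bracket_zero delta_hom_zero ins_zero)

lemma bilinear_familyI:
  assumes zero: "\<And>m n Q. Q \<in> cochains n \<Longrightarrow> B m n 0 Q = 0" "\<And>m n P. P \<in> cochains m \<Longrightarrow> B m n P 0 = 0"
    and eq: "\<And>a b P Q. P \<in> cochains (Suc a) \<Longrightarrow> Q \<in> cochains (Suc b) \<Longrightarrow> B (Suc a) (Suc b) P Q = D a b P Q"
    and D: "\<And>a b P Q R. P \<in> cochains (Suc a) \<Longrightarrow> Q \<in> cochains (Suc a) \<Longrightarrow> R \<in> cochains (Suc b) \<Longrightarrow>
        D a b (P + Q) R = D a b P R + D a b Q R"
      "\<And>a b P Q R. P \<in> cochains (Suc a) \<Longrightarrow> Q \<in> cochains (Suc b) \<Longrightarrow> R \<in> cochains (Suc b) \<Longrightarrow>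
        D a b P (Q + R) = D a b P Q + D a b P R"
      "\<And>a b c P Q. P \<in> cochains (Suc a) \<Longrightarrow> Q \<in> cochains (Suc b) \<Longrightarrow> D a b (cscale c P) Q = cscale c (D a b P Q)"
      "\<And>a b c P Q. P \<in> cochains (Suc a) \<Longrightarrow> Q \<in> cochains (Suc b) \<Longrightarrow> D a b P (cscale c Q) = cscale c (D a b P Q)"
  shows "bilinear_family B"
  unfolding bilinear_family_def
proof (intro conjI allI impI)
  fix m n f g h assume "f \<in> C_Hom m" "g \<in> C_Hom m" "h \<in> C_Hom n"
  then show "B m n (f + g) h = B m n f h + B m n g h"
    by (cases m; cases n) (auto simp: zero eq D cochains_add cochains_zero)
next
  fix m n f g h assume "f \<in> C_Hom m" "g \<in> C_Hom n" "h \<in> C_Hom n"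
  then show "B m n f (g + h) = B m n f g + B m n f h"
    by (cases m; cases n) (auto simp: zero eq D cochains_add cochains_zero)
next
  fix m n c f g assume "f \<in> C_Hom m" "g \<in> C_Hom n"
  then show "B m n (cscale c f) g = cscale c (B m n f g)" "B m n f (cscale c g) = cscale c (B m n f g)"
    by (cases m; cases n; auto simp: zero eq D cochains_cscale cochains_zero)+
qed

lemma bilinear_family_NR_hom: "bilinear_family NR_hom"
proof (rule bilinear_familyI[where B = NR_hom and D = NR_op, OF NR_hom_zero NR_hom_eq_NR_op])
  fix a b P Q R assume "P \<in> cochains (Suc a)" "Q \<in> cochains (Suc a)" "R \<in> cochains (Suc b)"
  then show "NR_op a b (P + Q) R = NR_op a b P R + NR_op a b Q R"
    by (simp add: NR_op_def iota_add_left[OF cochains_multilinear] iota_add_right sign_act_add)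
next
  fix a b P Q R assume "P \<in> cochains (Suc a)" "Q \<in> cochains (Suc b)" "R \<in> cochains (Suc b)"
  then show "NR_op a b P (Q + R) = NR_op a b P Q + NR_op a b P R"
    by (simp add: NR_op_def iota_add_left[OF cochains_multilinear] iota_add_right sign_act_add)
next
  fix a b c P Q assume "P \<in> cochains (Suc a)" "Q \<in> cochains (Suc b)"
  then show "NR_op a b (cscale c P) Q = cscale c (NR_op a b P Q)" "NR_op a b P (cscale c Q) = cscale c (NR_op a b P Q)"
    by (simp_all add: NR_op_def iota_scale_left[OF cochains_multilinear] iota_scale_right cscale_right_distrib)
qed

lemma bilinear_family_FN_hom: "bilinear_family FN_hom"
proof (rule bilinear_familyI[where B = FN_hom and D = FN_op, OF FN_hom_zero FN_hom_eq_FN_op])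
  fix a b P Q R assume "P \<in> cochains (Suc a)" "Q \<in> cochains (Suc a)" "R \<in> cochains (Suc b)"
  then show "FN_op a b (P + Q) R = FN_op a b P R + FN_op a b Q R"
    by (simp add: FN_op_def coboundary_add cup_add_left iota_add_left[OF cochains_multilinear] iota_add_right sign_act_add)
next
  fix a b P Q R assume "P \<in> cochains (Suc a)" "Q \<in> cochains (Suc b)" "R \<in> cochains (Suc b)"
  then show "FN_op a b P (Q + R) = FN_op a b P Q + FN_op a b P R"
    by (simp add: FN_op_def coboundary_add cup_add_right iota_add_left[OF cochains_multilinear] iota_add_right sign_act_add)
next
  fix a b c P Q assume "P \<in> cochains (Suc a)" "Q \<in> cochains (Suc b)"
  then show "FN_op a b (cscale c P) Q = cscale c (FN_op a b P Q)" "FN_op a b P (cscale c Q) = cscale c (FN_op a b P Q)"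
    by (simp_all add: FN_op_def coboundary_scale cup_scale iota_scale_left[OF cochains_multilinear] iota_scale_right
        cscale_right_distrib)
qed

lemma FN_hom_C_Hom: "f \<in> C_Hom m \<Longrightarrow> g \<in> C_Hom n \<Longrightarrow> FN_hom m n f g \<in> C_Hom (m + n)"
  using FN_op_cochain C_Hom_subset_cochains[of f m] C_Hom_subset_cochains[of g n]
  by (cases m; cases n) (auto simp: FN_hom_zero FN_hom_eq_FN_op cochains_zero)

lemma graded_lie_algebra_FN: "graded_lie_algebra cscale C_Hom FN_bracket"
  unfolding FN_bracket_def
proof (rule graded_lie_algebra_extend2[OF bilinear_family_FN_hom, where s = 0])
  fix m n p f g h assume f: "f \<in> C_Hom (m + 0)" and g: "g \<in> C_Hom (n + 0)"
  show "FN_hom (m + 0) (n + 0) f g \<in> C_Hom (m + n + 0)"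
    using f g by (simp add: FN_hom_C_Hom)
  show "FN_hom (m + 0) (n + 0) f g = - sign_act (m * n) (FN_hom (n + 0) (m + 0) g f)"
  proof (cases "m = 0 \<or> n = 0")
    case True
    then show ?thesis using f g C_Hom_subset_cochains by (auto simp: FN_hom_zero)
  next
    case False
    then obtain a b where "m = Suc a" "n = Suc b" by (metis not0_implies_Suc)
    then show ?thesis using f g FN_op_skew[of f a g b] by (simp add: FN_hom_eq_FN_op)
  qed
  assume h: "h \<in> C_Hom (p + 0)"
  show "FN_hom (m + 0) (n + p + 0) f (FN_hom (n + 0) (p + 0) g h) =
      FN_hom (m + n + 0) (p + 0) (FN_hom (m + 0) (n + 0) f g) h
      + sign_act (m * n) (FN_hom (n + 0) (m + p + 0) g (FN_hom (m + 0) (p + 0) f h))"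
  proof (cases "m = 0 \<or> n = 0 \<or> p = 0")
    case True
    have "FN_hom m n f g \<in> cochains (m + n)" "FN_hom n p g h \<in> cochains (n + p)" "FN_hom m p f h \<in> cochains (m + p)"
      using f g h FN_hom_C_Hom C_Hom_subset_cochains by simp_all
    then show ?thesis
      using True f g h C_Hom_subset_cochains[of f m] C_Hom_subset_cochains[of g n] C_Hom_subset_cochains[of h p]
      by (auto simp: FN_hom_zero cochains_zero)
  next
    case False
    then obtain a b c where "m = Suc a" "n = Suc b" "p = Suc c" by (metis not0_implies_Suc)
    then show ?thesis
      using f g h FN_op_jacobi[of f a g b h c] FN_op_cochain[of f a g b] FN_op_cochain[of g b h c] FN_op_cochain[of f a h c]
      by (simp add: FN_hom_eq_FN_op)
  qed
qed simp_all

lemma graded_lie_algebra_NR: "graded_lie_algebra cscale C_Hom_shift NR_bracket"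
  unfolding NR_bracket_def
proof (rule graded_lie_algebra_extend2[OF bilinear_family_NR_hom, where s = 1])
  fix m n p f g h assume f: "f \<in> C_Hom (m + 1)" and g: "g \<in> C_Hom (n + 1)"
  show "NR_hom (m + 1) (n + 1) f g \<in> C_Hom (m + n + 1)"
    using f g NR_op_cochain by (simp add: NR_hom_eq_NR_op)
  show "NR_hom (m + 1) (n + 1) f g = - sign_act (m * n) (NR_hom (n + 1) (m + 1) g f)"
    using f g by (simp add: NR_hom_eq_NR_op NR_op_def) (simp add: sign_act_def)
  assume h: "h \<in> C_Hom (p + 1)"
  show "NR_hom (m + 1) (n + p + 1) f (NR_hom (n + 1) (p + 1) g h) =
      NR_hom (m + n + 1) (p + 1) (NR_hom (m + 1) (n + 1) f g) h
      + sign_act (m * n) (NR_hom (n + 1) (m + p + 1) g (NR_hom (m + 1) (p + 1) f h))"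
    using f g h NR_op_jacobi[of f m g n h p] by (simp add: NR_hom_eq_NR_op NR_op_cochain)
qed (simp_all add: C_Hom_shift_def)

lemma delta_Hom_superset:
  assumes "f \<in> cochain_space" "finite M" "{m. hpart m f \<noteq> 0} \<subseteq> M"
  shows "delta_Hom f = (\<Sum>m\<in>M. delta_hom m (hpart m f))"
  unfolding delta_Hom_def extend1_def
  using assms by (intro sum.mono_neutral_left) (auto simp: delta_hom_zero)

lemma delta_Hom_homogeneous:
  assumes "f \<in> C_Hom m"
  shows "delta_Hom f = delta_hom m f"
proof -
  interpret V: vector_space cscale by (rule vector_space_cscale)
  have "f \<in> cochain_space" using assms by (blast intro: V.span_base)
  then have "delta_Hom f = (\<Sum>i\<in>{m}. delta_hom i (hpart i f))"
    by (rule delta_Hom_superset) (auto simp: hpart_C_Hom[OF assms])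
  then show ?thesis by (simp add: hpart_C_Hom[OF assms])
qed

lemma delta_Hom_zero: "delta_Hom 0 = 0"
  by (simp add: delta_Hom_def extend1_def)

lemma delta_hom_linear:
  assumes "f \<in> C_Hom m" "g \<in> C_Hom m"
  shows "delta_hom m (f + g) = delta_hom m f + delta_hom m g" "delta_hom m (cscale c f) = cscale c (delta_hom m f)"
  using assms
  by (cases m; simp add: delta_hom_zero delta_hom_eq_coboundary cochains_add cochains_cscale coboundary_add coboundary_scale)+

lemma delta_Hom_linear:
  assumes f: "f \<in> cochain_space" and g: "g \<in> cochain_space"
  shows "delta_Hom (f + g) = delta_Hom f + delta_Hom g" "delta_Hom (cscale c f) = cscale c (delta_Hom f)"
proof -
  interpret V: vector_space cscale by (rule vector_space_cscale)
  define M where "M = {m. hpart m f \<noteq> 0} \<union> {m. hpart m g \<noteq> 0}"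
  have M: "finite M" unfolding M_def using cochain_space_hpart(1) f g by blast
  have sub: "{m. hpart m f \<noteq> 0} \<subseteq> M" "{m. hpart m g \<noteq> 0} \<subseteq> M" "{m. hpart m (f + g) \<noteq> 0} \<subseteq> M"
    "{m. hpart m (cscale c f) \<noteq> 0} \<subseteq> M"
    by (auto simp: M_def hpart_add hpart_cscale)
  have fg: "f + g \<in> cochain_space" and cf: "cscale c f \<in> cochain_space"
    using f g by (auto intro: V.span_add V.span_scale)
  note hp = cochain_space_hpart(2)[OF f] cochain_space_hpart(2)[OF g]
  show "delta_Hom (f + g) = delta_Hom f + delta_Hom g"
    unfolding delta_Hom_superset[OF fg M sub(3)] delta_Hom_superset[OF f M sub(1)] delta_Hom_superset[OF g M sub(2)]
    by (simp add: hpart_add delta_hom_linear(1)[OF hp] sum.distrib)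
  show "delta_Hom (cscale c f) = cscale c (delta_Hom f)"
    unfolding delta_Hom_superset[OF cf M sub(4)] delta_Hom_superset[OF f M sub(1)] V.scale_sum_right
    by (simp add: hpart_cscale delta_hom_linear(2)[OF hp(1,1)])
qed

lemma delta_hom_C_Hom: "f \<in> C_Hom m \<Longrightarrow> delta_hom m f \<in> C_Hom (Suc m)"
  by (cases m) (auto simp: delta_hom_zero cochains_zero delta_hom_eq_coboundary coboundary_cochain)

lemma delta_Hom_cochain_space:
  assumes "f \<in> cochain_space"
  shows "delta_Hom f \<in> cochain_space"
  using assms
proof (induction rule: cochain_space_induct)
  interpret V: vector_space cscale by (rule vector_space_cscale)
  case zero
  show ?case by (simp only: delta_Hom_zero V.span_zero)
next
  interpret V: vector_space cscale by (rule vector_space_cscale)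
  case (homogeneous f n)
  then have "delta_Hom f \<in> C_Hom (Suc n)" by (simp only: delta_Hom_homogeneous delta_hom_C_Hom)
  then show ?case by (blast intro: V.span_base)
next
  interpret V: vector_space cscale by (rule vector_space_cscale)
  case (add f g)
  then show ?case by (simp only: delta_Hom_linear(1) V.span_add)
qed

text \<open>
  In positive arities this is \<open>coboundary_FN_op\<close>; in arity 0 both sides vanish.
\<close>

lemma delta_Hom_FN_bracket_homogeneous:
  assumes "f \<in> C_Hom m" "g \<in> C_Hom n"
  shows "delta_Hom (FN_bracket f g) = NR_bracket (delta_Hom f) (delta_Hom g)"
proof -
  have B: "FN_bracket f g = FN_hom m n f g"
    "NR_bracket (delta_Hom f) (delta_Hom g) = NR_hom (Suc m) (Suc n) (delta_hom m f) (delta_hom n g)"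
    unfolding FN_bracket_def NR_bracket_def delta_Hom_homogeneous[OF assms(1)] delta_Hom_homogeneous[OF assms(2)]
    by (rule extend2_homogeneous[OF bilinear_family_FN_hom assms])
      (intro extend2_homogeneous[OF bilinear_family_NR_hom] delta_hom_C_Hom assms)
  show ?thesis
  proof (cases "m = 0 \<or> n = 0")
    case True
    have "f \<in> cochains m" "g \<in> cochains n" "delta_hom m f \<in> cochains (Suc m)" "delta_hom n g \<in> cochains (Suc n)"
      using assms delta_hom_C_Hom C_Hom_subset_cochains by blast+
    then show ?thesis using True assms unfolding B
      by (auto simp: FN_hom_zero delta_hom_zero NR_hom_zero delta_Hom_homogeneous[of 0 0])
  next
    case False
    then obtain a b where ab: "m = Suc a" "n = Suc b" by (metis not0_implies_Suc)
    then have f: "f \<in> cochains (Suc a)" and g: "g \<in> cochains (Suc b)" using assms by simp_all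
    have "FN_op a b f g \<in> C_Hom (Suc (Suc (a + b)))" using FN_op_cochain[OF f g] by simp
    then have "delta_Hom (FN_op a b f g) = coboundary (Suc (a + b)) (FN_op a b f g)"
      unfolding delta_hom_eq_coboundary[OF FN_op_cochain[OF f g], symmetric] by (rule delta_Hom_homogeneous)
    then show ?thesis
      unfolding B ab by (simp add: FN_hom_eq_FN_op[OF f g] delta_hom_eq_coboundary[OF f] delta_hom_eq_coboundary[OF g]
          NR_hom_eq_NR_op[OF coboundary_cochain[OF f] coboundary_cochain[OF g]] coboundary_FN_op[OF f g])
  qed
qed

lemma graded_lie_algebra_morphism_delta_Hom:
  "graded_lie_algebra_morphism cscale C_Hom FN_bracket cscale C_Hom_shift NR_bracket delta_Hom"
proof -
  interpret A: graded_lie_algebra cscale C_Hom FN_bracket by (rule graded_lie_algebra_FN)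
  interpret B: graded_lie_algebra cscale C_Hom_shift NR_bracket by (rule graded_lie_algebra_NR)
  note FN_bil = extend2_bilinear[OF bilinear_family_FN_hom, folded FN_bracket_def]
  note NR_bil = extend2_bilinear[OF bilinear_family_NR_hom, folded NR_bracket_def]
  note FN_zero = extend2_zero[of FN_hom, folded FN_bracket_def]
  note NR_zero = extend2_zero[of NR_hom, folded NR_bracket_def]
  have closed: "FN_bracket f g \<in> cochain_space" if "f \<in> cochain_space" "g \<in> cochain_space" for f g
    using that
  proof (induction rule: cochain_space_induct)
    case (homogeneous f m)
    then have f: "f \<in> cochain_space" by (blast intro: A.span_base)
    show ?case
      using homogeneous.prems
    proof (induction rule: cochain_space_induct)
      case (homogeneous g n)
      have "FN_bracket f g \<in> C_Hom (m + n)" by (rule A.brk_degree) fact+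
      then show ?case by (blast intro: A.span_base)
    next
      case (add g h)
      then show ?case by (simp only: FN_bil(2)[OF _ _ f] A.span_add)
    qed (simp only: FN_zero A.span_zero)
  next
    case (add f h)
    then show ?case by (simp only: FN_bil(1) A.span_add)
  qed (simp only: FN_zero A.span_zero)
  show ?thesis
  proof unfold_locales
    fix f g assume f: "f \<in> cochain_space" and g: "g \<in> cochain_space"
    show "delta_Hom (FN_bracket f g) = NR_bracket (delta_Hom f) (delta_Hom g)"
      using f
    proof (induction rule: cochain_space_induct)
      case (homogeneous f m)
      then have f: "f \<in> cochain_space" by (blast intro: A.span_base)
      show ?case
        using g
      proof (induction rule: cochain_space_induct)
        case (homogeneous g n)
        show ?case by (rule delta_Hom_FN_bracket_homogeneous) fact+
      next
        case (add g h)
        then show ?case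
          by (simp only: FN_bil(2)[OF _ _ f] NR_bil(2)[OF _ _ delta_Hom_cochain_space[OF f]]
              delta_Hom_linear(1) closed[OF f] delta_Hom_cochain_space)
      qed (simp only: FN_zero NR_zero delta_Hom_zero)
    next
      case (add f h)
      then show ?case
        using g by (simp only: FN_bil(1) NR_bil(1) delta_Hom_linear(1) closed delta_Hom_cochain_space)
    qed (simp only: FN_zero NR_zero delta_Hom_zero)
  qed (simp_all add: delta_Hom_linear delta_Hom_homogeneous C_Hom_shift_def delta_hom_C_Hom[simplified])
qed

end

section \<open>The Froelicher-Nijenhuis algebra and the differential\<close>

theorem theorem4p6:
  fixes scale :: "'k::field_char_0 \<Rightarrow> 'v::ab_group_add \<Rightarrow> 'v"
    and lie :: "'v \<Rightarrow> 'v \<Rightarrow> 'v"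
    and \<alpha> :: "'v \<Rightarrow> 'v"
  assumes "hom_lie_algebra scale lie \<alpha>"
  shows "graded_lie_algebra
           (hom_lie_algebra.cscale scale)
           (hom_lie_algebra.C_Hom scale \<alpha>)
           (hom_lie_algebra.FN_bracket scale lie \<alpha>)
       \<and> graded_lie_algebra_morphism
           (hom_lie_algebra.cscale scale)
           (hom_lie_algebra.C_Hom scale \<alpha>)
           (hom_lie_algebra.FN_bracket scale lie \<alpha>)
           (hom_lie_algebra.cscale scale)
           (hom_lie_algebra.C_Hom_shift scale \<alpha>)
           (hom_lie_algebra.NR_bracket scale \<alpha>)
           (hom_lie_algebra.delta_Hom scale lie \<alpha>)"
proof -
  interpret hom_lie_algebra scale lie \<alpha> by (rule assms)
  show ?thesis using graded_lie_algebra_FN graded_lie_algebra_morphism_delta_Hom by simp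
qed

end
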